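(* Let $m\in\mathbb{Q}_{>0}$. The map $\psi_{*,m}:\mathbb{Q}[\mu]\langle Y\rangle^0[T]\to\mathbb{Q}[\mu]\langle Y\rangle$, $\sum_{i}w_iT^i\mapsto\sum_i w_i\ast_\mu y_{1,m}^{\ast_\mu i}$ (where $y_{1,m}^{\ast_\mu i}$ is the $i$-fold $\ast_\mu$-power of $y_{1,m}$, and $\mathbb{Q}[\mu]\langle Y\rangle^0[T]$ is the polynomial ring over the commutative algebra $(\mathbb{Q}[\mu]\langle Y\rangle^0,\ast_\mu)$), is an isomorphism of $(\mathbb{Q}[\mu]\langle Y\rangle^0,\ast_\mu)$-algebras onto $(\mathbb{Q}[\mu]\langle Y\rangle,\ast_\mu)$.
   Context: Fix $\mu\in\mathbb{C}$, $\mathrm{Re}(\mu)>0$; $\mathbb{Q}[\mu]\subset\mathbb{C}$ the ring generated by $\mu$. $Y=\{y_{k,m}:k\in\mathbb{N},m\in\mathbb{Q}_{>0}\}$, $\mathbb{Q}[\mu]\langle Y\rangle$ the free $\mathbb{Q}[\mu]$-module on words over $Y$ with concatenation; $y_{\mathbf{k};\mathbf{m}}=y_{k_1,m_1}\cdots y_{k_r,m_r}$. $\odot$ on letters: $y_{k_1,m}\odot y_{k_2,m}=y_{k_1+k_2,m}$; for $m_1\ne m_2$, $y_{k_1,m_1}\odot y_{k_2,m_2}=\sum_{i\le k_1}a_iy_{i,m_1}+\sum_{j\le k_2}b_jy_{j,m_2}$ with $\frac{1}{(x+m_1)^{k_1}(x+m_2)^{k_2}}=\sum\frac{a_i}{(x+m_1)^i}+\sum\frac{b_j}{(x+m_2)^j}$.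 The $\mu$-stuffle product $\ast_\mu$: bilinear, $1\ast_\mu w=w\ast_\mu1=w$, $ux\ast_\mu vy=(u\ast_\mu vy)x+(ux\ast_\mu v)y-\mu(u\ast_\mu v)(x\odot y)$ for letters $x,y$; it is commutative and associative. Admissible words: $1$ and $y_{\mathbf{k};\mathbf{m}}$ with $k_r>1$. Quasi-admissible elements: $y_{k_1,m_1}\cdots y_{k_{r-1},m_{r-1}}(y_{1,m_r}-y_{1,\tilde m_r})$ with $\tilde m_r\ne m_r$. $\mathbb{Q}[\mu]\langle Y\rangle^0$ is the span of admissible words and quasi-admissible elements; it is a $\ast_\mu$-subalgebra. *)

theory Defs
  imports
    Complex_Main
    "HOL-Library.Poly_Mapping"
    "HOL-Computational_Algebra.Polynomial"
    "HOL-Algebra.UnivPoly"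
    "HOL-Algebra.QuotRing"
begin

text \<open>The letter \<open>y\<^bsub>k,m\<^esub>\<close> is encoded as the pair \<open>(k, m)\<close>; only pairs in \<open>letters\<close>
  (\<open>k \<ge> 1\<close>, \<open>m > 0\<close>) are letters of the alphabet \<open>Y\<close>. Elements of the free module are finitely
  supported functions on words; restricting the support to words over \<open>Y\<close> and the coefficients
  to the subring \<open>\<rat>[\<mu>]\<close> is done by the carrier set \<open>QY\<close>.\<close>

type_synonym letter = "nat \<times> rat"
type_synonym word = "letter list"
type_synonym elt = "word \<Rightarrow>\<^sub>0 complex"

definition letters :: "letter set" where
  "letters = {(k, m). 1 \<le> k \<and> 0 < m}"

definition Qadj :: "complex \<Rightarrow> complex set" where
  "Qadj \<mu> = range (\<lambda>p :: rat poly. poly (map_poly of_rat p) \<mu>)"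

definition QY :: "complex \<Rightarrow> elt set" where
  "QY \<mu> = {p. Poly_Mapping.keys p \<subseteq> lists letters \<and> (\<forall>w. Poly_Mapping.lookup p w \<in> Qadj \<mu>)}"

definition word :: "word \<Rightarrow> elt" where
  "word w = Poly_Mapping.single w 1"

definition scale :: "complex \<Rightarrow> elt \<Rightarrow> elt" where
  "scale c p = Poly_Mapping.map ((*) c) p"

definition bilin :: "(word \<Rightarrow> word \<Rightarrow> elt) \<Rightarrow> elt \<Rightarrow> elt \<Rightarrow> elt" where
  "bilin f p q = (\<Sum>u\<in>Poly_Mapping.keys p. \<Sum>v\<in>Poly_Mapping.keys q.
      scale (Poly_Mapping.lookup p u * Poly_Mapping.lookup q v) (f u v))"

definition conc :: "elt \<Rightarrow> elt \<Rightarrow> elt" where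
  "conc = bilin (\<lambda>u v. word (u @ v))"

definition is_partial_fraction ::
    "letter \<Rightarrow> letter \<Rightarrow> (nat \<Rightarrow> rat) \<Rightarrow> (nat \<Rightarrow> rat) \<Rightarrow> bool" where
  "is_partial_fraction = (\<lambda>(k1, m1) (k2, m2) a b.
     (\<forall>i. i \<notin> {1..k1} \<longrightarrow> a i = 0) \<and> (\<forall>j. j \<notin> {1..k2} \<longrightarrow> b j = 0) \<and>
     (\<forall>x. x + m1 \<noteq> 0 \<longrightarrow> x + m2 \<noteq> 0 \<longrightarrow>
        1 / ((x + m1) ^ k1 * (x + m2) ^ k2) =
          (\<Sum>i=1..k1. a i / (x + m1) ^ i) + (\<Sum>j=1..k2. b j / (x + m2) ^ j)))"

text \<open>Well-defined for letters with different second index, see \<open>partial_fraction_ex1\<close> below.\<close>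

definition partial_fraction :: "letter \<Rightarrow> letter \<Rightarrow> (nat \<Rightarrow> rat) \<times> (nat \<Rightarrow> rat)" where
  "partial_fraction x y = (THE ab. is_partial_fraction x y (fst ab) (snd ab))"

definition letter_odot :: "letter \<Rightarrow> letter \<Rightarrow> elt" where
  "letter_odot x y =
     (if snd x = snd y then word [(fst x + fst y, snd x)]
      else (\<Sum>i=1..fst x. scale (of_rat (fst (partial_fraction x y) i)) (word [(i, snd x)])) +
           (\<Sum>j=1..fst y. scale (of_rat (snd (partial_fraction x y) j)) (word [(j, snd y)])))"

text \<open>The recursion removes the last letter of each word, cf. \<open>stuffle_word_snoc\<close> below.\<close>

function stuffle_word :: "complex \<Rightarrow> word \<Rightarrow> word \<Rightarrow> elt" where
  "stuffle_word \<mu> u v =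
     (if u = [] then word v
      else if v = [] then word u
      else conc (stuffle_word \<mu> (butlast u) v) (word [last u])
         + conc (stuffle_word \<mu> u (butlast v)) (word [last v])
         - scale \<mu> (conc (stuffle_word \<mu> (butlast u) (butlast v)) (letter_odot (last u) (last v))))"
  by auto
termination
  by (relation "measure (\<lambda>(\<mu>, u, v). length u + length v)") (auto simp flip: length_greater_0_conv)

declare stuffle_word.simps [simp del]

definition stuffle :: "complex \<Rightarrow> elt \<Rightarrow> elt \<Rightarrow> elt" where
  "stuffle \<mu> = bilin (stuffle_word \<mu>)"

definition admissible :: "elt set" where
  "admissible = insert (word [])
     {word (u @ [(k, m)]) | u k m. u \<in> lists letters \<and> (k, m) \<in> letters \<and> 1 < k}"

definition quasi_admissible :: "elt set" where
  "quasi_admissible =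
     {conc (word u) (word [(1, m)] - word [(1, m')]) | u m m'.
        u \<in> lists letters \<and> (1, m) \<in> letters \<and> (1, m') \<in> letters \<and> m' \<noteq> m}"

definition Qadj_span :: "complex \<Rightarrow> elt set \<Rightarrow> elt set" where
  "Qadj_span \<mu> G = {\<Sum>g\<in>S. scale (c g) g | S c. finite S \<and> S \<subseteq> G \<and> c ` S \<subseteq> Qadj \<mu>}"

definition QY0 :: "complex \<Rightarrow> elt set" where
  "QY0 \<mu> = Qadj_span \<mu> (admissible \<union> quasi_admissible)"

text \<open>The scalar multiplication of \<open>stuffle_algebra\<close> is the one by elements of the subring
  \<open>stuffle_algebra0\<close>, which is the product \<open>stuffle \<mu>\<close> itself.\<close>

definition stuffle_algebra :: "complex \<Rightarrow> (elt, elt) module" where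
  "stuffle_algebra \<mu> =
     \<lparr>carrier = QY \<mu>, mult = stuffle \<mu>, one = word [], zero = 0, add = (+), smult = stuffle \<mu>\<rparr>"

definition stuffle_algebra0 :: "complex \<Rightarrow> elt ring" where
  "stuffle_algebra0 \<mu> =
     \<lparr>carrier = QY0 \<mu>, mult = stuffle \<mu>, one = word [], zero = 0, add = (+)\<rparr>"

definition psi :: "complex \<Rightarrow> rat \<Rightarrow> (nat \<Rightarrow> elt) \<Rightarrow> elt" where
  "psi \<mu> m p =
     (\<Oplus>\<^bsub>stuffle_algebra \<mu>\<^esub>i\<in>{..deg (stuffle_algebra0 \<mu>) p}.
        up_ring.coeff (UP (stuffle_algebra0 \<mu>)) p i \<otimes>\<^bsub>stuffle_algebra \<mu>\<^esub>
          (word [(1, m)] [^]\<^bsub>stuffle_algebra \<mu>\<^esub> i))"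

definition algebra_iso ::
    "('r, 'x) ring_scheme \<Rightarrow> ('r, 'a, 'y) module_scheme \<Rightarrow> ('r, 'b, 'z) module_scheme \<Rightarrow>
      ('a \<Rightarrow> 'b) set" where
  "algebra_iso R M N =
     {h. algebra R M \<and> algebra R N \<and> h \<in> ring_iso M N \<and>
         (\<forall>a\<in>carrier R. \<forall>x\<in>carrier M. h (a \<odot>\<^bsub>M\<^esub> x) = a \<odot>\<^bsub>N\<^esub> h x)}"

lemma stuffle_word_Nil:
  "stuffle_word \<mu> [] w = word w" "stuffle_word \<mu> w [] = word w"
  by (simp_all add: stuffle_word.simps)

lemma stuffle_word_snoc:
  "stuffle_word \<mu> (u @ [x]) (v @ [y]) =
     conc (stuffle_word \<mu> u (v @ [y])) (word [x])
   + conc (stuffle_word \<mu> (u @ [x]) v) (word [y])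
   - scale \<mu> (conc (stuffle_word \<mu> u v) (letter_odot x y))"
  by (subst stuffle_word.simps) simp

lemma partial_fraction_exists:
  assumes "m1 \<noteq> m2" "0 < k1 + k2"
  shows "\<exists>a b. is_partial_fraction (k1, m1) (k2, m2) a b"
  using assms(2)
proof (induction "k1 + k2" arbitrary: k1 k2 rule: less_induct)
  case less
  consider "k1 = 0" | "k2 = 0" | "0 < k1" "0 < k2" by blast
  then show ?case
  proof cases
    case 1
    with less.prems have "is_partial_fraction (k1, m1) (k2, m2) (\<lambda>_. 0) (\<lambda>j. if j = k2 then 1 else 0)"
      by (auto simp: is_partial_fraction_def if_distrib[of "\<lambda>t. t / _"] cong: if_cong)
    then show ?thesis by blast
  next
    case 2
    with less.prems have "is_partial_fraction (k1, m1) (k2, m2) (\<lambda>i. if i = k1 then 1 else 0) (\<lambda>_. 0)"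
      by (auto simp: is_partial_fraction_def if_distrib[of "\<lambda>t. t / _"] cong: if_cong)
    then show ?thesis by blast
  next
    case 3
    then obtain l1 l2 where l: "k1 = Suc l1" "k2 = Suc l2"
      by (metis gr0_conv_Suc)
    obtain a b where ab: "is_partial_fraction (k1, m1) (l2, m2) a b"
      using less.hyps[of k1 l2] l by auto
    obtain c d where cd: "is_partial_fraction (l1, m1) (k2, m2) c d"
      using less.hyps[of l1 k2] l by auto
    define e where "e = m2 - m1"
    have e: "e \<noteq> 0" using assms by (simp add: e_def)
    have "is_partial_fraction (k1, m1) (k2, m2) (\<lambda>i. (a i - c i) / e) (\<lambda>j. (b j - d j) / e)"
      unfolding is_partial_fraction_def prod.case
    proof (intro conjI allI impI)
      fix i show "i \<notin> {1..k1} \<Longrightarrow> (a i - c i) / e = 0"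
        using ab cd l by (auto simp: is_partial_fraction_def)
    next
      fix i show "i \<notin> {1..k2} \<Longrightarrow> (b i - d i) / e = 0"
        using ab cd l by (auto simp: is_partial_fraction_def)
    next
      fix x assume x: "x + m1 \<noteq> 0" "x + m2 \<noteq> 0"
      define A where "A = x + m1"
      define B where "B = x + m2"
      have AB: "A \<noteq> 0" "B \<noteq> 0" "e = B - A" using x by (auto simp: A_def B_def e_def)
      have c0: "c k1 = 0" and b0: "b k2 = 0"
        using ab cd l by (auto simp: is_partial_fraction_def)
      have 1: "1 / (A ^ k1 * B ^ l2) = (\<Sum>i=1..k1. a i / A ^ i) + (\<Sum>j=1..k2. b j / B ^ j)"
        using ab x b0 l by (simp add: is_partial_fraction_def A_def B_def)
      have 2: "1 / (A ^ l1 * B ^ k2) = (\<Sum>i=1..k1. c i / A ^ i) + (\<Sum>j=1..k2. d j / B ^ j)"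
        using cd x c0 l by (simp add: is_partial_fraction_def A_def B_def)
      have "1 / (A ^ k1 * B ^ k2) = (1 / (A ^ k1 * B ^ l2) - 1 / (A ^ l1 * B ^ k2)) / e"
      proof -
        have "1 / (A ^ k1 * B ^ l2) = B / (A ^ k1 * B ^ k2)" "1 / (A ^ l1 * B ^ k2) = A / (A ^ k1 * B ^ k2)"
          using AB(1,2) l by simp_all
        then show ?thesis using e by (simp only: AB(3) flip: diff_divide_distrib) simp
      qed
      also have "\<dots> = (\<Sum>i=1..k1. (a i - c i) / e / A ^ i) + (\<Sum>j=1..k2. (b j - d j) / e / B ^ j)"
      proof -
        have "(p - q) / e / t = (p / t - q / t) / e" for p q t :: rat
          by (simp add: diff_divide_distrib mult.commute)
        then show ?thesis
          unfolding 1 2 by (simp only: sum_subtractf flip: sum_divide_distrib add_divide_distrib)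
            (simp only: add_diff_add)
      qed
      finally show "1 / ((x + m1) ^ k1 * (x + m2) ^ k2) =
          (\<Sum>i=1..k1. (a i - c i) / e / (x + m1) ^ i) + (\<Sum>j=1..k2. (b j - d j) / e / (x + m2) ^ j)"
        by (simp add: A_def B_def)
    qed
    then show ?thesis by blast
  qed
qed

lemma partial_fraction_top_zero:
  fixes a b :: "nat \<Rightarrow> rat"
  assumes "m1 \<noteq> m2" "0 < k1"
    and eq: "\<And>x. x + m1 \<noteq> 0 \<Longrightarrow> x + m2 \<noteq> 0 \<Longrightarrow>
      (\<Sum>i=1..k1. a i / (x + m1) ^ i) + (\<Sum>j=1..k2. b j / (x + m2) ^ j) = 0"
  shows "a k1 = 0"
proof -
  define P :: "rat poly" where
    "P = (\<Sum>i=1..k1. Polynomial.smult (a i) ([:m1, 1:] ^ (k1 - i) * [:m2, 1:] ^ k2)) +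
         (\<Sum>j=1..k2. Polynomial.smult (b j) ([:m1, 1:] ^ k1 * [:m2, 1:] ^ (k2 - j)))"
  have P: "poly P x = (\<Sum>i=1..k1. a i * ((x + m1) ^ (k1 - i) * (x + m2) ^ k2)) +
         (\<Sum>j=1..k2. b j * ((x + m1) ^ k1 * (x + m2) ^ (k2 - j)))" for x
    by (simp add: P_def poly_sum add.commute)
  have zero: "poly P x = 0" if x: "x + m1 \<noteq> 0" "x + m2 \<noteq> 0" for x
  proof -
    have "poly P x = (x + m1) ^ k1 * (x + m2) ^ k2 *
        ((\<Sum>i=1..k1. a i / (x + m1) ^ i) + (\<Sum>j=1..k2. b j / (x + m2) ^ j))"
      unfolding P distrib_left sum_distrib_left
      by (intro arg_cong2[of _ _ _ _ "(+)"] sum.cong) (use x in \<open>auto simp: power_diff\<close>)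
    then show ?thesis using eq[OF x] by simp
  qed
  have "P = 0"
  proof (rule ccontr)
    assume "P \<noteq> 0"
    then have "finite ({x. poly P x = 0} \<union> {- m1, - m2})"
      by (simp add: poly_roots_finite)
    moreover have "{x. poly P x = 0} \<union> {- m1, - m2} = UNIV"
      using zero by (auto simp: eq_neg_iff_add_eq_0)
    ultimately show False using infinite_UNIV_char_0[where 'a = rat] by metis
  qed
  then have "0 = poly P (- m1)" by simp
  also have "\<dots> = (\<Sum>i=1..k1. if i = k1 then a i * (m2 - m1) ^ k2 else 0)"
  proof -
    have "(\<Sum>i=1..k1. a i * ((- m1 + m1) ^ (k1 - i) * (- m1 + m2) ^ k2)) =
        (\<Sum>i=1..k1. if i = k1 then a i * (m2 - m1) ^ k2 else 0)"
      by (intro sum.cong) (auto simp: power_0_left)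
    moreover have "(\<Sum>j=1..k2. b j * ((- m1 + m1) ^ k1 * (- m1 + m2) ^ (k2 - j))) = 0"
      using assms(2) by (simp add: power_0_left)
    ultimately show ?thesis unfolding P by simp
  qed
  also have "\<dots> = a k1 * (m2 - m1) ^ k2"
    using assms(2) by simp
  finally show ?thesis using assms(1) by simp
qed

lemma partial_fraction_zero:
  fixes a b :: "nat \<Rightarrow> rat"
  assumes "m1 \<noteq> m2"
    and "\<And>x. x + m1 \<noteq> 0 \<Longrightarrow> x + m2 \<noteq> 0 \<Longrightarrow>
      (\<Sum>i=1..k1. a i / (x + m1) ^ i) + (\<Sum>j=1..k2. b j / (x + m2) ^ j) = 0"
  shows "(\<forall>i\<in>{1..k1}. a i = 0) \<and> (\<forall>j\<in>{1..k2}. b j = 0)"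
  using assms(2)
proof (induction "k1 + k2" arbitrary: k1 k2)
  case 0
  then show ?case by simp
next
  case (Suc n)
  show ?case
  proof (cases k1)
    case (Suc l)
    have top: "a k1 = 0"
      by (rule partial_fraction_top_zero[OF assms(1) _ Suc.prems]) (simp_all add: Suc)
    have "(\<forall>i\<in>{1..l}. a i = 0) \<and> (\<forall>j\<in>{1..k2}. b j = 0)"
    proof (rule Suc.hyps(1))
      fix x assume "x + m1 \<noteq> 0" "x + m2 \<noteq> 0"
      from Suc.prems[OF this] show "(\<Sum>i=1..l. a i / (x + m1) ^ i) + (\<Sum>j=1..k2. b j / (x + m2) ^ j) = 0"
        using top by (simp add: Suc)
    qed (use Suc.hyps(2) Suc in simp)
    then show ?thesis using top Suc by (auto simp: le_Suc_eq)
  next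
    case 0
    then obtain l where l: "k2 = Suc l" using Suc.hyps(2) by auto
    have top: "b k2 = 0"
    proof (rule partial_fraction_top_zero[OF assms(1)[symmetric]])
      fix x assume "x + m2 \<noteq> 0" "x + m1 \<noteq> 0"
      from Suc.prems[OF this(2,1)]
      show "(\<Sum>i=1..k2. b i / (x + m2) ^ i) + (\<Sum>j=1..k1. a j / (x + m1) ^ j) = 0"
        by (simp only: add.commute)
    qed (simp add: l)
    have "(\<forall>i\<in>{1..k1}. a i = 0) \<and> (\<forall>j\<in>{1..l}. b j = 0)"
    proof (rule Suc.hyps(1))
      fix x assume "x + m1 \<noteq> 0" "x + m2 \<noteq> 0"
      from Suc.prems[OF this] show "(\<Sum>i=1..k1. a i / (x + m1) ^ i) + (\<Sum>j=1..l. b j / (x + m2) ^ j) = 0"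
        using top by (simp add: l)
    qed (use Suc.hyps(2) l in simp)
    then show ?thesis using top l by (auto simp: le_Suc_eq)
  qed
qed

lemma partial_fraction_ex1:
  assumes "x \<in> letters" "y \<in> letters" "snd x \<noteq> snd y"
  shows "\<exists>!ab. is_partial_fraction x y (fst ab) (snd ab)"
proof -
  obtain k1 m1 k2 m2 where xy: "x = (k1, m1)" "y = (k2, m2)" by fastforce
  have m: "m1 \<noteq> m2" and k: "0 < k1 + k2" using assms xy by (auto simp: letters_def)
  obtain a b where ab: "is_partial_fraction x y a b"
    using partial_fraction_exists[OF m k] xy by blast
  have "c = a \<and> d = b" if cd: "is_partial_fraction x y c d" for c d
  proof -
    have "(\<forall>i\<in>{1..k1}. c i - a i = 0) \<and> (\<forall>j\<in>{1..k2}. d j - b j = 0)"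
    proof (rule partial_fraction_zero[OF m])
      fix t assume t: "t + m1 \<noteq> 0" "t + m2 \<noteq> 0"
      have "(\<Sum>i=1..k1. c i / (t + m1) ^ i) + (\<Sum>j=1..k2. d j / (t + m2) ^ j) =
            (\<Sum>i=1..k1. a i / (t + m1) ^ i) + (\<Sum>j=1..k2. b j / (t + m2) ^ j)"
        using ab cd t unfolding is_partial_fraction_def xy prod.case by metis
      then show "(\<Sum>i=1..k1. (c i - a i) / (t + m1) ^ i) + (\<Sum>j=1..k2. (d j - b j) / (t + m2) ^ j) = 0"
        by (simp add: diff_divide_distrib sum_subtractf)
    qed
    moreover have "c i = a i" if "i \<notin> {1..k1}" for i
      using ab cd that by (simp add: is_partial_fraction_def xy)
    moreover have "d j = b j" if "j \<notin> {1..k2}" for j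
      using ab cd that by (simp add: is_partial_fraction_def xy)
    ultimately have "c i = a i" "d i = b i" for i
      by (metis eq_iff_diff_eq_0)+
    then show ?thesis by (simp add: fun_eq_iff)
  qed
  then have uniq: "ab' = (a, b)" if "is_partial_fraction x y (fst ab') (snd ab')" for ab'
    using that by (metis prod.collapse)
  show ?thesis
  proof (rule ex1I)
    show "is_partial_fraction x y (fst (a, b)) (snd (a, b))" using ab by simp
  qed (rule uniq)
qed

lemma is_partial_fraction_partial_fraction:
  assumes "x \<in> letters" "y \<in> letters" "snd x \<noteq> snd y"
  shows "is_partial_fraction x y (fst (partial_fraction x y)) (snd (partial_fraction x y))"
  unfolding partial_fraction_def by (rule theI'[OF partial_fraction_ex1[OF assms]])

end

theory Submission
  imports Defs
begin

text \<open>Let \<open>D\<close> be the linear map with \<open>D (w y\<^bsub>1,m\<^esub>) = w\<close> that kills all other words. The residues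
  of \<open>1 / ((x + m\<^sub>1)\<^bsup>k\<^sub>1\<^esup> (x + m\<^sub>2)\<^bsup>k\<^sub>2\<^esup>)\<close> sum up to \<open>0\<close>, so \<open>D\<close> kills \<open>x \<odot> y\<close> for all letters, and the
  recursion for the stuffle product then says that \<open>D\<close> is a derivation. It lowers the length of
  words, its kernel is spanned by the admissible and quasi-admissible elements, and it maps
  \<open>y\<^bsub>1,m\<^esub>\<close> to \<open>1\<close>. Over a \<open>\<rat>\<close>-algebra, a locally nilpotent derivation with such a slice makes the
  algebra the polynomial ring in the slice over its kernel. Commutativity and
  associativity of the product reduce to those of \<open>\<odot>\<close>, which is multiplication of rational
  functions because partial fractions are linearly independent.\<close>

section \<open>Linear extension\<close>

lemma lookup_scale [simp]: "Poly_Mapping.lookup (scale c p) w = c * Poly_Mapping.lookup p w"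
  by (simp add: scale_def Poly_Mapping.map.rep_eq when_def)

lemma lookup_word: "Poly_Mapping.lookup (word u) w = (if u = w then 1 else 0)"
  by (simp add: word_def lookup_single when_def)

lemma keys_word [simp]: "Poly_Mapping.keys (word w) = {w}"
  by (simp add: word_def)

lemma keys_scale: "Poly_Mapping.keys (scale c p) \<subseteq> Poly_Mapping.keys p"
  by (auto simp: in_keys_iff)

lemma scale_add_right: "scale c (p + q) = scale c p + scale c q"
  and scale_diff_right: "scale c (p - q) = scale c p - scale c q"
  and scale_add_left: "scale (c + d) p = scale c p + scale d p"
  and scale_scale [simp]: "scale c (scale d p) = scale (c * d) p"
  and scale_one [simp]: "scale 1 p = p"
  and scale_zero_left [simp]: "scale 0 p = 0"
  and scale_zero_right [simp]: "scale c 0 = 0"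
  and scale_minus_one: "scale (- 1) p = - p"
  by (rule poly_mapping_eqI; simp add: lookup_add lookup_minus algebra_simps)+

lemma diff_eq_add_scale: "p - q = p + scale (- 1) q"
  by (simp add: scale_minus_one)

lemma scale_sum: "scale c (\<Sum>i\<in>I. f i) = (\<Sum>i\<in>I. scale c (f i))"
  by (induction I rule: infinite_finite_induct) (simp_all add: scale_add_right)

lemma elt_eq_sum:
  assumes "finite S" "Poly_Mapping.keys p \<subseteq> S"
  shows "p = (\<Sum>w\<in>S. scale (Poly_Mapping.lookup p w) (word w))"
proof (rule poly_mapping_eqI)
  fix u
  have "(\<Sum>w\<in>S. Poly_Mapping.lookup p w * (if w = u then 1 else 0)) = Poly_Mapping.lookup p u"
    using assms by (auto simp: in_keys_iff if_distrib cong: if_cong)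
  then show "Poly_Mapping.lookup p u =
      Poly_Mapping.lookup (\<Sum>w\<in>S. scale (Poly_Mapping.lookup p w) (word w)) u"
    by (simp add: lookup_sum lookup_word)
qed

text \<open>The scaled step keeps the coefficients of \<open>p\<close> itself, so a claim that
  depends on them, such as membership in \<open>Qadj \<mu>\<close>, can be carried through the
  induction.\<close>

lemma elt_induct_scaled [consumes 1, case_names zero scaled add]:
  assumes "Poly_Mapping.keys p \<subseteq> S"
    and "P 0" and "\<And>w. w \<in> S \<Longrightarrow> P (scale (Poly_Mapping.lookup p w) (word w))"
    and "\<And>q r. P q \<Longrightarrow> P r \<Longrightarrow> P (q + r)"
  shows "P p"
proof -
  have "P (\<Sum>w\<in>A. scale (Poly_Mapping.lookup p w) (word w))" if "finite A" "A \<subseteq> S" for A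
    using that by (induction A rule: finite_induct) (auto intro: assms)
  from this[OF finite_keys assms(1)] show ?thesis
    using elt_eq_sum[OF finite_keys subset_refl, of p] by simp
qed

lemma elt_induct [consumes 1, case_names zero word scale add]:
  assumes "Poly_Mapping.keys p \<subseteq> S"
    and "P 0" and "\<And>w. w \<in> S \<Longrightarrow> P (word w)"
    and "\<And>c q. P q \<Longrightarrow> P (scale c q)"
    and "\<And>q r. P q \<Longrightarrow> P r \<Longrightarrow> P (q + r)"
  shows "P p"
  using assms(1) by (rule elt_induct_scaled) (auto intro: assms)

definition lin :: "(word \<Rightarrow> elt) \<Rightarrow> elt \<Rightarrow> elt" where
  "lin f p = (\<Sum>u\<in>Poly_Mapping.keys p. scale (Poly_Mapping.lookup p u) (f u))"

lemma lin_superset: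
  assumes "finite S" "Poly_Mapping.keys p \<subseteq> S"
  shows "lin f p = (\<Sum>u\<in>S. scale (Poly_Mapping.lookup p u) (f u))"
  unfolding lin_def using assms by (intro sum.mono_neutral_left) (auto simp: in_keys_iff)

lemma lin_word [simp]: "lin f (word w) = f w"
  by (simp add: lin_def lookup_word)

lemma lin_zero [simp]: "lin f 0 = 0"
  by (simp add: lin_def)

lemma lin_add: "lin f (p + q) = lin f p + lin f q"
  unfolding lin_def by (rule setsum_keys_plus_distrib) (simp_all add: scale_add_left)

lemma lin_scale: "lin f (scale c p) = scale c (lin f p)"
proof -
  have "lin f (scale c p) = (\<Sum>u\<in>Poly_Mapping.keys p. scale (c * Poly_Mapping.lookup p u) (f u))"
    using lin_superset[OF finite_keys keys_scale, of f c p] by simp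
  then show ?thesis by (simp add: lin_def scale_sum)
qed

lemma lin_diff: "lin f (p - q) = lin f p - lin f q"
  by (simp add: diff_eq_add_scale lin_add lin_scale)

lemma lin_add_fun: "lin (\<lambda>u. f u + g u) p = lin f p + lin g p"
  by (simp add: lin_def scale_add_right sum.distrib)

lemma lin_scale_fun: "lin (\<lambda>u. scale c (f u)) p = scale c (lin f p)"
  by (simp add: lin_def scale_sum mult.commute)

lemma bilin_eq_lin: "bilin f p q = lin (\<lambda>u. lin (f u) q) p"
  by (simp add: bilin_def lin_def scale_sum)

lemma bilin_simps:
  "bilin f (p + q) r = bilin f p r + bilin f q r"
  "bilin f p (q + r) = bilin f p q + bilin f p r"
  "bilin f (p - q) r = bilin f p r - bilin f q r"
  "bilin f p (q - r) = bilin f p q - bilin f p r"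
  "bilin f (scale c p) q = scale c (bilin f p q)"
  "bilin f p (scale c q) = scale c (bilin f p q)"
  "bilin f 0 q = 0" "bilin f p 0 = 0"
  "bilin f (word u) (word v) = f u v"
  by (simp_all add: bilin_eq_lin diff_eq_add_scale lin_add lin_scale lin_add_fun lin_scale_fun)
     (simp add: lin_def)

lemmas conc_simps = bilin_simps[of "\<lambda>u v. word (u @ v)", folded conc_def]

lemmas stuffle_simps = bilin_simps[of "stuffle_word \<mu>" for \<mu>, folded stuffle_def]

text \<open>Bilinear extension of \<open>letter_odot\<close>; only its values on one-letter words matter.\<close>

definition odot :: "elt \<Rightarrow> elt \<Rightarrow> elt" where
  "odot = bilin (\<lambda>u v. letter_odot (last u) (last v))"

lemmas odot_simps = bilin_simps[of "\<lambda>u v. letter_odot (last u) (last v)", folded odot_def]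

text \<open>The map \<open>D\<close> of the overview. It treats all second indices alike, so each
  \<open>word [(1, m)]\<close> goes to \<open>word []\<close>, the unit of the product.\<close>

definition last_deriv :: "elt \<Rightarrow> elt" where
  "last_deriv = lin (\<lambda>w. if w \<noteq> [] \<and> fst (last w) = 1 then word (butlast w) else 0)"

lemma last_deriv_simps:
  "last_deriv (p + q) = last_deriv p + last_deriv q"
  "last_deriv (p - q) = last_deriv p - last_deriv q"
  "last_deriv (scale c p) = scale c (last_deriv p)"
  "last_deriv 0 = 0"
  by (simp_all add: last_deriv_def lin_add lin_diff lin_scale)

lemma last_deriv_word [simp]:
  "last_deriv (word w) = (if w \<noteq> [] \<and> fst (last w) = 1 then word (butlast w) else 0)"
  by (simp add: last_deriv_def)

abbreviation singletons :: "letter set \<Rightarrow> word set" where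
  "singletons S \<equiv> (\<lambda>x. [x]) ` S"

text \<open>\<open>letter_odot\<close> yields a combination of letters, so associativity requires
  the recursion with such combinations in last place. It follows from
  \<open>stuffle_word_snoc\<close> by bilinearity.\<close>

lemma stuffle_conc:
  assumes "Poly_Mapping.keys L \<subseteq> singletons UNIV" "Poly_Mapping.keys M \<subseteq> singletons UNIV"
  shows "stuffle \<mu> (conc p L) (conc q M) =
     conc (stuffle \<mu> p (conc q M)) L + conc (stuffle \<mu> (conc p L) q) M
     - scale \<mu> (conc (stuffle \<mu> p q) (odot L M))"
proof -
  have *: "Poly_Mapping.keys p \<subseteq> UNIV" for p :: elt by simp
  note bil = conc_simps stuffle_simps odot_simps scale_add_right
  \<comment> \<open>Moving the \<open>odot\<close> term to the left leaves an identity without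
    subtraction for the inductions.\<close>
  have "stuffle \<mu> (conc p L) (conc q M) + scale \<mu> (conc (stuffle \<mu> p q) (odot L M)) =
     conc (stuffle \<mu> p (conc q M)) L + conc (stuffle \<mu> (conc p L) q) M"
    using *[of p]
  proof (induction p rule: elt_induct)
    case (word u)
    from *[of q] show ?case
    proof (induction q rule: elt_induct)
      case (word v)
      from assms(1) show ?case
      proof (induction L rule: elt_induct)
        case (word x)
        from assms(2) show ?case
        proof (induction M rule: elt_induct)
          case (word y)
          with \<open>x \<in> _\<close> show ?case by (auto simp: bil stuffle_word_snoc)
        next
          case (scale c q)
          from arg_cong[OF this, of "scale c"] show ?case by (simp add: bil algebra_simps)
        qed (simp_all add: bil algebra_simps)
      next
        case (scale c q)
        from arg_cong[OF this, of "scale c"] show ?case by (simp add: bil algebra_simps)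
      qed (simp_all add: bil algebra_simps)
    next
      case (scale c q)
      from arg_cong[OF this, of "scale c"] show ?case by (simp add: bil algebra_simps)
    qed (simp_all add: bil algebra_simps)
  next
    case (scale c q)
    from arg_cong[OF this, of "scale c"] show ?case by (simp add: bil algebra_simps)
  qed (simp_all add: bil algebra_simps)
  then show ?thesis by (simp add: algebra_simps)
qed

section \<open>Supports of linear combinations\<close>

lemma keys_subset_add:
  "Poly_Mapping.keys p \<subseteq> S \<Longrightarrow> Poly_Mapping.keys q \<subseteq> S \<Longrightarrow> Poly_Mapping.keys (p + q) \<subseteq> S"
  using keys_add[of p q] by blast

lemma keys_subset_scale: "Poly_Mapping.keys p \<subseteq> S \<Longrightarrow> Poly_Mapping.keys (scale c p) \<subseteq> S"
  using keys_scale[of c p] by blast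

lemma keys_subset_diff:
  fixes p q :: elt
  shows "Poly_Mapping.keys p \<subseteq> S \<Longrightarrow> Poly_Mapping.keys q \<subseteq> S \<Longrightarrow> Poly_Mapping.keys (p - q) \<subseteq> S"
  unfolding diff_eq_add_scale by (intro keys_subset_add keys_subset_scale)

lemma keys_subset_sum:
  "(\<And>i. i \<in> I \<Longrightarrow> Poly_Mapping.keys (f i) \<subseteq> S) \<Longrightarrow> Poly_Mapping.keys (sum f I) \<subseteq> S"
  using keys_sum[of f I] by blast

lemma keys_subset_lin:
  "(\<And>u. u \<in> Poly_Mapping.keys p \<Longrightarrow> Poly_Mapping.keys (f u) \<subseteq> S) \<Longrightarrow>
    Poly_Mapping.keys (lin f p) \<subseteq> S"
  unfolding lin_def by (intro keys_subset_sum keys_subset_scale)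

section \<open>Letters as rational functions\<close>

text \<open>The rational function 1 / (x + m)^k sampled at x = n. For a letter, m > 0 keeps natural
  numbers away from the pole.\<close>

definition letter_val :: "nat \<Rightarrow> letter \<Rightarrow> complex" where
  "letter_val n x = 1 / (of_nat n + of_rat (snd x)) ^ fst x"

text \<open>Meant for combinations of one-letter words, where \<open>last\<close> reads off the
  letter.\<close>

definition val :: "nat \<Rightarrow> elt \<Rightarrow> complex" where
  "val n p = (\<Sum>w\<in>Poly_Mapping.keys p. Poly_Mapping.lookup p w * letter_val n (last w))"

lemma val_add: "val n (p + q) = val n p + val n q"
  unfolding val_def by (rule setsum_keys_plus_distrib) (simp_all add: algebra_simps)

lemma val_zero [simp]: "val n 0 = 0"
  by (simp add: val_def)

lemma val_word [simp]: "val n (word w) = letter_val n (last w)"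
  by (simp add: val_def lookup_word)

lemma val_scale: "val n (scale c p) = c * val n p"
proof -
  have "val n (scale c p) =
      (\<Sum>w\<in>Poly_Mapping.keys p. Poly_Mapping.lookup (scale c p) w * letter_val n (last w))"
    unfolding val_def using keys_scale
    by (intro sum.mono_neutral_left) (auto simp: in_keys_iff)
  then show ?thesis by (simp add: val_def sum_distrib_left mult.assoc)
qed

lemma val_diff: "val n (p - q) = val n p - val n q"
  by (simp add: diff_eq_add_scale val_add val_scale)

lemma val_sum: "val n (sum f I) = (\<Sum>i\<in>I. val n (f i))"
  by (induction I rule: infinite_finite_induct) (simp_all add: val_add)

lemma keys_letter_odot:
  assumes "x \<in> letters" "y \<in> letters"
  shows "Poly_Mapping.keys (letter_odot x y) \<subseteq> singletons letters"
proof (cases "snd x = snd y")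
  case True
  then show ?thesis using assms by (auto simp: letter_odot_def letters_def)
next
  case False
  have "[(i, snd x)] \<in> singletons letters" "[(i, snd y)] \<in> singletons letters" if "i \<ge> 1" for i
    using assms that by (auto simp: letters_def)
  then show ?thesis
    unfolding letter_odot_def if_not_P[OF False]
    by (intro keys_subset_add keys_subset_sum keys_subset_scale) simp_all
qed

lemma of_nat_add_of_rat_nonzero:
  assumes "m > 0"
  shows "of_nat n + of_rat m \<noteq> (0 :: complex)"
proof -
  have "of_rat (of_nat n + m) \<noteq> (0 :: complex)"
    using assms by (simp add: add_nonneg_eq_0_iff)
  then show ?thesis by (simp add: of_rat_add)
qed

text \<open>For equal second indices the exponents add. Otherwise the partial fraction identity is
  taken at x = n, where no denominator vanishes, and carried from the rationals to the complex
  numbers.\<close>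

lemma val_letter_odot:
  assumes "x \<in> letters" "y \<in> letters"
  shows "val n (letter_odot x y) = letter_val n x * letter_val n y"
proof (cases "snd x = snd y")
  case True
  then show ?thesis
    by (simp add: letter_odot_def letter_val_def power_add)
next
  case False
  obtain k1 m1 k2 m2 where xy: "x = (k1, m1)" "y = (k2, m2)" by fastforce
  define a where "a = fst (partial_fraction x y)"
  define b where "b = snd (partial_fraction x y)"
  have m: "m1 > 0" "m2 > 0" using assms xy by (auto simp: letters_def)
  have nz: "rat_of_nat n + m1 \<noteq> 0" "rat_of_nat n + m2 \<noteq> 0"
    using m by (simp_all add: add_nonneg_eq_0_iff)
  have "1 / ((of_nat n + m1) ^ k1 * (of_nat n + m2) ^ k2) =
          (\<Sum>i=1..k1. a i / (of_nat n + m1) ^ i) + (\<Sum>j=1..k2. b j / (of_nat n + m2) ^ j)"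
    using is_partial_fraction_partial_fraction[OF assms False] nz
    unfolding is_partial_fraction_def xy prod.case a_def b_def by blast
  from arg_cong[OF this, of "of_rat :: rat \<Rightarrow> complex"]
  have "1 / ((of_nat n + of_rat m1) ^ k1 * (of_nat n + of_rat m2) ^ k2) =
      (\<Sum>i=1..k1. of_rat (a i) / (of_nat n + of_rat m1) ^ i) +
      (\<Sum>j=1..k2. of_rat (b j) / (of_nat n + of_rat m2 :: complex) ^ j)"
    by (simp add: of_rat_add of_rat_sum of_rat_divide of_rat_mult of_rat_power)
  then show ?thesis
    using False
    by (simp add: letter_odot_def letter_val_def val_add val_sum val_scale xy
        flip: a_def[unfolded xy] b_def[unfolded xy])
qed

lemma val_odot:
  assumes "Poly_Mapping.keys p \<subseteq> singletons letters" "Poly_Mapping.keys q \<subseteq> singletons letters"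
  shows "val n (odot p q) = val n p * val n q"
  using assms(1)
proof (induction p rule: elt_induct)
  case (word u)
  from assms(2) show ?case
  proof (induction q rule: elt_induct)
    case (word v)
    with \<open>u \<in> _\<close> show ?case by (auto simp: odot_simps val_letter_odot)
  qed (simp_all add: odot_simps val_add val_scale algebra_simps)
qed (simp_all add: odot_simps val_add val_scale algebra_simps)

lemma keys_odot:
  assumes "Poly_Mapping.keys p \<subseteq> singletons letters" "Poly_Mapping.keys q \<subseteq> singletons letters"
  shows "Poly_Mapping.keys (odot p q) \<subseteq> singletons letters"
  unfolding odot_def bilin_eq_lin using assms
  by (intro keys_subset_lin keys_letter_odot) auto

text \<open>Partial fractions are linearly independent: clear denominators and look at a pole of
  maximal order.\<close>

lemma val_eq_0_imp_eq_0:
  assumes "Poly_Mapping.keys p \<subseteq> singletons letters" and val: "\<And>n. val n p = 0"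
  shows "p = 0"
proof (rule ccontr)
  assume "p \<noteq> 0"
  define S where "S = (\<lambda>x. [x]) -` Poly_Mapping.keys p"
  define c where "c x = Poly_Mapping.lookup p [x]" for x
  have S: "finite S" "S \<subseteq> letters" "Poly_Mapping.keys p = singletons S"
    using assms(1) by (auto simp: S_def inj_on_def intro!: finite_vimageI)
  then have "S \<noteq> {}" using \<open>p \<noteq> 0\<close> by auto
  have pos: "k \<ge> 1" "m > 0" if "(k, m) \<in> S" for k m
    using S(2) that by (auto simp: letters_def)
  obtain m0 where m0: "m0 \<in> snd ` S" using \<open>S \<noteq> {}\<close> by blast
  \<comment> \<open>The maximal order of the pole at \<open>- of_rat m0\<close> among the letters of
    the support.\<close>
  define K where "K = Max {k. (k, m0) \<in> S}"
  have fin: "finite {k. (k, m0) \<in> S}"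
    by (rule finite_subset[OF _ finite_imageI[OF S(1), of fst]]) force
  have KS: "(K, m0) \<in> S"
    using Max_in[OF fin] m0 by (force simp: K_def)
  have le_K: "k \<le> K" if "(k, m0) \<in> S" for k
    using Max_ge[OF fin] that by (simp add: K_def)
  \<comment> \<open>A common bound for all pole orders; it serves to clear the poles other than the
    one at \<open>- of_rat m0\<close>.\<close>
  define N where "N = Max (fst ` S)"
  have le_N: "k \<le> N" if "(k, m) \<in> S" for k m
    unfolding N_def using S(1) that by (force intro!: Max_ge)
  define M where "M = snd ` S - {m0}"
  have fM: "finite M" using S(1) by (simp add: M_def)
  define X where "X m = [:of_rat m :: complex, 1:]" for m
  have X: "poly (X m) t = t + of_rat m" for m t by (simp add: X_def add.commute)
  \<comment> \<open>The fraction of the letter times the common denominator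
    \<open>X m0 ^ K * (\<Prod>m'\<in>M. X m' ^ N)\<close>, written with its own denominator already
    cancelled.\<close>
  define Q where "Q = (\<lambda>(k, m). if m = m0 then X m0 ^ (K - k) * (\<Prod>m'\<in>M. X m' ^ N)
      else X m0 ^ K * X m ^ (N - k) * (\<Prod>m'\<in>M - {m}. X m' ^ N))"
  define P where "P = (\<Sum>x\<in>S. Polynomial.smult (c x) (Q x))"
  have "poly P (of_nat n) = 0" for n
  proof -
    define d where "d m = of_nat n + (of_rat m :: complex)" for m
    have d: "d m \<noteq> 0" if "m \<in> snd ` S" for m
      using that of_nat_add_of_rat_nonzero pos by (force simp: d_def)
    have "poly (Q x) (of_nat n) = d m0 ^ K * (\<Prod>m'\<in>M. d m' ^ N) * letter_val n x"
      if "x \<in> S" for x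
    proof -
      obtain k m where x: "x = (k, m)" by fastforce
      have dm: "d m \<noteq> 0" using that d by (force simp: x)
      show ?thesis
      proof (cases "m = m0")
        case True
        then show ?thesis using dm le_K[of k] that
          by (simp add: Q_def x X poly_prod letter_val_def power_diff flip: d_def)
      next
        case False
        then have "m \<in> M" using that by (force simp: M_def x)
        then have "(\<Prod>m'\<in>M. d m' ^ N) = d m ^ N * (\<Prod>m'\<in>M - {m}. d m' ^ N)"
          using fM by (simp add: prod.remove)
        then show ?thesis using dm le_N[of k m] that False
          by (simp add: Q_def x X poly_prod letter_val_def power_diff flip: d_def)
      qed
    qed
    then have "poly P (of_nat n) =
        d m0 ^ K * (\<Prod>m'\<in>M. d m' ^ N) * (\<Sum>x\<in>S. c x * letter_val n x)"
      by (simp add: P_def poly_sum sum_distrib_left mult_ac)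
    also have "(\<Sum>x\<in>S. c x * letter_val n x) = val n p"
      by (simp add: val_def S(3) sum.reindex inj_on_def c_def)
    finally show ?thesis by (simp add: val)
  qed
  \<comment> \<open>Every natural number is a root of \<open>P\<close>, too many for a nonzero
    polynomial.\<close>
  then have "range of_nat \<subseteq> {t. poly P t = 0}" by auto
  moreover have "infinite (range (of_nat :: nat \<Rightarrow> complex))"
    by (simp add: range_inj_infinite inj_of_nat)
  ultimately have "P = 0"
    using poly_roots_finite finite_subset by blast
  then have "0 = poly P (- of_rat m0)" by simp
  \<comment> \<open>At \<open>- of_rat m0\<close> every summand that retains a factor
    \<open>X m0\<close> vanishes; only the pole of maximal order retains none.\<close>
  also have "\<dots> = (\<Sum>x\<in>S. if x = (K, m0) then c x * poly (\<Prod>m'\<in>M. X m' ^ N) (- of_rat m0) else 0)"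
    unfolding P_def poly_sum poly_smult
  proof (rule sum.cong)
    fix x assume "x \<in> S"
    moreover obtain k m where x: "x = (k, m)" by fastforce
    ultimately show "c x * poly (Q x) (- of_rat m0) =
        (if x = (K, m0) then c x * poly (\<Prod>m'\<in>M. X m' ^ N) (- of_rat m0) else 0)"
      using le_K[of k] pos[OF KS] by (auto simp: Q_def X power_0_left)
  qed simp
  also have "\<dots> = c (K, m0) * (\<Prod>m'\<in>M. (of_rat m' - of_rat m0) ^ N)"
    using KS S(1) by (simp add: poly_prod X)
  finally have "c (K, m0) = 0"
    using fM by (auto simp: M_def)
  then show False
    using KS by (simp add: S_def c_def in_keys_iff)
qed

text \<open>Reduces identities between combinations of letters to identities between complex
  numbers.\<close>

lemma val_inject:
  assumes "Poly_Mapping.keys p \<subseteq> singletons letters" "Poly_Mapping.keys q \<subseteq> singletons letters"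
    and "\<And>n. val n p = val n q"
  shows "p = q"
  using val_eq_0_imp_eq_0[of "p - q"] assms by (simp add: keys_subset_diff val_diff)

lemma letter_odot_commute:
  "x \<in> letters \<Longrightarrow> y \<in> letters \<Longrightarrow> letter_odot x y = letter_odot y x"
  by (rule val_inject) (simp_all add: keys_letter_odot val_letter_odot)

text \<open>\<open>val\<close> turns \<open>odot\<close> into multiplication of numbers, which is
  associative.\<close>

lemma odot_assoc:
  assumes "Poly_Mapping.keys p \<subseteq> singletons letters" "Poly_Mapping.keys q \<subseteq> singletons letters"
    "Poly_Mapping.keys r \<subseteq> singletons letters"
  shows "odot (odot p q) r = odot p (odot q r)"
  using assms by (intro val_inject) (simp_all add: keys_odot val_odot)

section \<open>Behaviour at infinity and residues\<close>

lemma tendsto_inverse_of_nat_add: "(\<lambda>n. 1 / (of_nat n + c :: complex)) \<longlonglongrightarrow> 0"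
proof -
  have "filterlim (\<lambda>n. c + of_nat n) at_infinity sequentially"
    by (rule tendsto_add_filterlim_at_infinity[OF tendsto_const tendsto_of_nat])
  then show ?thesis
    by (intro tendsto_divide_0[OF tendsto_const]) (simp add: add.commute)
qed

text \<open>A letter with first index k decays like 1 / n^k, so after multiplication by n a nonzero
  limit remains only for k = 1.\<close>

lemma letter_val_tendsto:
  assumes "x \<in> letters"
  shows "(\<lambda>n. letter_val n x) \<longlonglongrightarrow> 0"
    and "(\<lambda>n. of_nat n * letter_val n x) \<longlonglongrightarrow> (if fst x = 1 then 1 else 0)"
proof -
  define m where "m = (of_rat (snd x) :: complex)"
  define f where "f n = 1 / (of_nat n + m)" for n
  have nz: "of_nat n + m \<noteq> 0" for n
    using assms of_nat_add_of_rat_nonzero by (auto simp: m_def letters_def)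
  obtain k where k: "fst x = Suc k"
    using assms by (cases "fst x") (auto simp: letters_def)
  have f: "f \<longlonglongrightarrow> 0" unfolding f_def by (rule tendsto_inverse_of_nat_add)
  have val: "letter_val n x = f n * f n ^ k" for n
    by (simp add: letter_val_def f_def m_def k power_divide)
  show "(\<lambda>n. letter_val n x) \<longlonglongrightarrow> 0"
    unfolding val by (rule tendsto_eq_intros f | simp)+
  \<comment> \<open>This is n / (n + m) = 1 - m / (n + m); the exponent \<open>k\<close> is one less
    than the first index.\<close>
  have "of_nat n * letter_val n x = (1 - m * f n) * f n ^ k" for n
    using nz[of n] by (simp add: val f_def field_simps)
  moreover have "(\<lambda>n. (1 - m * f n) * f n ^ k) \<longlonglongrightarrow> (1 - m * 0) * 0 ^ k"
    by (intro tendsto_intros f)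
  ultimately show "(\<lambda>n. of_nat n * letter_val n x) \<longlonglongrightarrow> (if fst x = 1 then 1 else 0)"
    by (simp add: k power_0_left)
qed

text \<open>On one-letter words \<open>last_deriv\<close> adds up the coefficients of the letters
  with first index 1. These are the residues, and by \<open>letter_val_tendsto\<close> only they
  contribute to the limit.\<close>

lemma val_tendsto_last_deriv:
  assumes "Poly_Mapping.keys p \<subseteq> singletons letters"
  shows "(\<lambda>n. of_nat n * val n p) \<longlonglongrightarrow> Poly_Mapping.lookup (last_deriv p) []"
  using assms
proof (induction p rule: elt_induct)
  case (word w)
  then obtain x where "w = [x]" "x \<in> letters" by blast
  then show ?case
    using letter_val_tendsto(2)[of x]
    by (simp add: lookup_word if_distrib if_distribR cong: if_cong)
next
  case (scale c q)
  then have "(\<lambda>n. c * (of_nat n * val n q)) \<longlonglongrightarrow> c * Poly_Mapping.lookup (last_deriv q) []"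
    by (intro tendsto_intros)
  then show ?case by (simp add: val_scale last_deriv_simps mult_ac)
next
  case (add q r)
  from tendsto_add[OF this] show ?case
    by (simp add: val_add last_deriv_simps lookup_add algebra_simps)
qed (simp add: last_deriv_simps)

text \<open>The residues of a rational function that vanishes to second order at infinity sum up to \<open>0\<close>.\<close>

lemma last_deriv_letter_odot:
  assumes "x \<in> letters" "y \<in> letters"
  shows "last_deriv (letter_odot x y) = 0"
proof (rule poly_mapping_eqI)
  fix w
  note keys = keys_letter_odot[OF assms]
  \<comment> \<open>One factor of the product still converges after multiplication by n, and the
    other tends to 0.\<close>
  have "(\<lambda>n. of_nat n * val n (letter_odot x y)) \<longlonglongrightarrow> (if fst x = 1 then 1 else 0) * 0"
    unfolding val_letter_odot[OF assms] mult.assoc[symmetric]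
    by (intro tendsto_mult letter_val_tendsto assms)
  then have "Poly_Mapping.lookup (last_deriv (letter_odot x y)) [] = 0"
    using LIMSEQ_unique[OF val_tendsto_last_deriv[OF keys]] by simp
  \<comment> \<open>Removing the letter of a one-letter word leaves the empty word, whose
    coefficient has just been found to be 0.\<close>
  moreover have "Poly_Mapping.keys (last_deriv (letter_odot x y)) \<subseteq> {[]}"
    unfolding last_deriv_def using keys by (intro keys_subset_lin) auto
  ultimately show "Poly_Mapping.lookup (last_deriv (letter_odot x y)) w = Poly_Mapping.lookup 0 w"
    by (cases "w = []") (auto simp: in_keys_iff)
qed

section \<open>The stuffle product\<close>

lemma stuffle_one [simp]: "stuffle \<mu> (word []) p = p" "stuffle \<mu> p (word []) = p"
proof -
  have *: "Poly_Mapping.keys p \<subseteq> UNIV" by simp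
  show "stuffle \<mu> (word []) p = p"
    using * by (induction p rule: elt_induct) (simp_all add: stuffle_simps stuffle_word_Nil)
  show "stuffle \<mu> p (word []) = p"
    using * by (induction p rule: elt_induct) (simp_all add: stuffle_simps stuffle_word_Nil)
qed

text \<open>Induction on the total length: swapping the words exchanges the first two terms of the
  recursion and leaves the third to the commutativity of \<open>letter_odot\<close>.\<close>

lemma stuffle_word_commute:
  "u \<in> lists letters \<Longrightarrow> v \<in> lists letters \<Longrightarrow> stuffle_word \<mu> u v = stuffle_word \<mu> v u"
proof (induction "length u + length v" arbitrary: u v rule: less_induct)
  case less
  show ?case
  proof (cases u rule: rev_cases)
    case u: (snoc u' x)
    show ?thesis
    proof (cases v rule: rev_cases)
      case v: (snoc v' y)
      have "stuffle_word \<mu> u' v = stuffle_word \<mu> v u'" "stuffle_word \<mu> u v' = stuffle_word \<mu> v' u"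
        "stuffle_word \<mu> u' v' = stuffle_word \<mu> v' u'"
        using less.prems by (auto intro!: less.hyps simp: u v)
      moreover have "letter_odot x y = letter_odot y x"
        using less.prems by (intro letter_odot_commute) (simp_all add: u v)
      ultimately show ?thesis
        by (simp add: u v stuffle_word_snoc)
    qed (simp add: stuffle_word_Nil)
  qed (simp add: stuffle_word_Nil)
qed

lemma stuffle_commute:
  assumes "Poly_Mapping.keys p \<subseteq> lists letters" "Poly_Mapping.keys q \<subseteq> lists letters"
  shows "stuffle \<mu> p q = stuffle \<mu> q p"
  using assms(1)
proof (induction p rule: elt_induct)
  case (word u)
  from assms(2) show ?case
  proof (induction q rule: elt_induct)
    case (word v)
    with \<open>u \<in> _\<close> show ?case by (simp add: stuffle_simps stuffle_word_commute)
  qed (simp_all add: stuffle_simps)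
qed (simp_all add: stuffle_simps)

text \<open>Expands a triple product by its last letters; every product on the right-hand side that
  is not inside a longer one has a shortened factor. The equations for \<open>A\<close>,
  \<open>B\<close> and \<open>C\<close> keep unshortened factors folded.\<close>

lemma stuffle_conc_conc_left:
  assumes "Poly_Mapping.keys L \<subseteq> singletons letters" "Poly_Mapping.keys M \<subseteq> singletons letters"
    "Poly_Mapping.keys N \<subseteq> singletons letters"
    and ABC: "A = conc p L" "B = conc q M" "C = conc r N"
  shows "stuffle \<mu> (stuffle \<mu> A B) C =
    conc (stuffle \<mu> (stuffle \<mu> p B) C) L + conc (stuffle \<mu> (stuffle \<mu> A q) C) M
    + conc (stuffle \<mu> (stuffle \<mu> A B) r) N
    - scale \<mu> (conc (stuffle \<mu> (stuffle \<mu> p q) C) (odot L M)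
      + conc (stuffle \<mu> (stuffle \<mu> p B) r) (odot L N)
      + conc (stuffle \<mu> (stuffle \<mu> A q) r) (odot M N))
    + scale (\<mu> * \<mu>) (conc (stuffle \<mu> (stuffle \<mu> p q) r) (odot (odot L M) N))"
proof -
  \<comment> \<open>Naming the inner products lets the recursion act on the outer product alone. The
    terms ending in \<open>N\<close> then recombine to the product of
    \<open>stuffle \<mu> A B\<close> with \<open>r\<close>.\<close>
  define a b c where "a = stuffle \<mu> p B" and "b = stuffle \<mu> A q" and "c = stuffle \<mu> p q"
  have keys: "Poly_Mapping.keys L \<subseteq> singletons UNIV" "Poly_Mapping.keys M \<subseteq> singletons UNIV"
    "Poly_Mapping.keys N \<subseteq> singletons UNIV" "Poly_Mapping.keys (odot L M) \<subseteq> singletons UNIV"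
    using assms(1-3) keys_odot[OF assms(1,2)] by blast+
  have AB: "stuffle \<mu> A B = conc a L + conc b M - scale \<mu> (conc c (odot L M))"
    unfolding ABC(1,2) a_def b_def c_def by (rule stuffle_conc) (rule keys)+
  have C: "stuffle \<mu> (conc s K) C =
      conc (stuffle \<mu> s C) K + conc (stuffle \<mu> (conc s K) r) N - scale \<mu> (conc (stuffle \<mu> s r) (odot K N))"
    if "Poly_Mapping.keys K \<subseteq> singletons UNIV" for s K
    unfolding ABC(3) by (rule stuffle_conc[OF that keys(3)])
  show ?thesis
    unfolding AB a_def[symmetric] b_def[symmetric] c_def[symmetric]
    by (simp add: stuffle_simps conc_simps C keys scale_add_right scale_diff_right algebra_simps)
qed

text \<open>Mirror image of \<open>stuffle_conc_conc_left\<close>: the seven terms correspond one by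
  one, differing only in bracketing.\<close>

lemma stuffle_conc_conc_right:
  assumes "Poly_Mapping.keys L \<subseteq> singletons letters" "Poly_Mapping.keys M \<subseteq> singletons letters"
    "Poly_Mapping.keys N \<subseteq> singletons letters"
    and ABC: "A = conc p L" "B = conc q M" "C = conc r N"
  shows "stuffle \<mu> A (stuffle \<mu> B C) =
    conc (stuffle \<mu> p (stuffle \<mu> B C)) L + conc (stuffle \<mu> A (stuffle \<mu> q C)) M
    + conc (stuffle \<mu> A (stuffle \<mu> B r)) N
    - scale \<mu> (conc (stuffle \<mu> p (stuffle \<mu> q C)) (odot L M)
      + conc (stuffle \<mu> p (stuffle \<mu> B r)) (odot L N)
      + conc (stuffle \<mu> A (stuffle \<mu> q r)) (odot M N))
    + scale (\<mu> * \<mu>) (conc (stuffle \<mu> p (stuffle \<mu> q r)) (odot L (odot M N)))"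
proof -
  define a b c where "a = stuffle \<mu> q C" and "b = stuffle \<mu> B r" and "c = stuffle \<mu> q r"
  have keys: "Poly_Mapping.keys L \<subseteq> singletons UNIV" "Poly_Mapping.keys M \<subseteq> singletons UNIV"
    "Poly_Mapping.keys N \<subseteq> singletons UNIV" "Poly_Mapping.keys (odot M N) \<subseteq> singletons UNIV"
    using assms(1-3) keys_odot[OF assms(2,3)] by blast+
  have BC: "stuffle \<mu> B C = conc a M + conc b N - scale \<mu> (conc c (odot M N))"
    unfolding ABC(2,3) a_def b_def c_def by (rule stuffle_conc) (rule keys)+
  have A: "stuffle \<mu> A (conc s K) =
      conc (stuffle \<mu> p (conc s K)) L + conc (stuffle \<mu> A s) K - scale \<mu> (conc (stuffle \<mu> p s) (odot L K))"
    if "Poly_Mapping.keys K \<subseteq> singletons UNIV" for s K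
    unfolding ABC(1) by (rule stuffle_conc[OF keys(1) that])
  show ?thesis
    unfolding BC a_def[symmetric] b_def[symmetric] c_def[symmetric]
    by (simp add: stuffle_simps conc_simps A keys scale_add_right scale_diff_right algebra_simps)
qed

text \<open>Induction on the total length. Both bracketings expand into seven terms, each with at
  least one factor shortened, and the last pair agrees because \<open>odot\<close> is
  associative.\<close>

lemma stuffle_word_assoc:
  assumes "u \<in> lists letters" "v \<in> lists letters" "w \<in> lists letters"
  shows "stuffle \<mu> (stuffle \<mu> (word u) (word v)) (word w) =
    stuffle \<mu> (word u) (stuffle \<mu> (word v) (word w))"
  using assms
proof (induction "length u + length v + length w" arbitrary: u v w rule: less_induct)
  case less
  consider "u = []" | "v = []" | "w = []"
    | u' x v' y w' z where "u = u' @ [x]" "v = v' @ [y]" "w = w' @ [z]"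
    by (metis rev_exhaust)
  then show ?case
  proof cases
    case 4
    have letters: "x \<in> letters" "y \<in> letters" "z \<in> letters"
      and lists: "u' \<in> lists letters" "v' \<in> lists letters" "w' \<in> lists letters"
      using less.prems 4 by auto
    have keys: "Poly_Mapping.keys (word [x]) \<subseteq> singletons letters"
      "Poly_Mapping.keys (word [y]) \<subseteq> singletons letters"
      "Poly_Mapping.keys (word [z]) \<subseteq> singletons letters"
      using letters by simp_all
    have conc: "word u = conc (word u') (word [x])" "word v = conc (word v') (word [y])"
      "word w = conc (word w') (word [z])"
      by (simp_all add: 4 conc_simps)
    have IH: "stuffle \<mu> (stuffle \<mu> (word a) (word b)) (word c) =
        stuffle \<mu> (word a) (stuffle \<mu> (word b) (word c))"
      if "a \<in> {u, u'}" "b \<in> {v, v'}" "c \<in> {w, w'}" "(a, b, c) \<noteq> (u, v, w)" for a b c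
      using that less.prems lists by (intro less.hyps) (auto simp: 4)
    show ?thesis
      unfolding stuffle_conc_conc_left[OF keys conc] stuffle_conc_conc_right[OF keys conc]
        odot_assoc[OF keys]
      by (simp add: IH 4)
  qed (simp_all)
qed

lemma stuffle_assoc:
  assumes "Poly_Mapping.keys p \<subseteq> lists letters" "Poly_Mapping.keys q \<subseteq> lists letters"
    "Poly_Mapping.keys r \<subseteq> lists letters"
  shows "stuffle \<mu> (stuffle \<mu> p q) r = stuffle \<mu> p (stuffle \<mu> q r)"
  using assms(1)
proof (induction p rule: elt_induct)
  case (word u)
  from assms(2) show ?case
  proof (induction q rule: elt_induct)
    case (word v)
    from assms(3) show ?case
    proof (induction r rule: elt_induct)
      case (word w)
      with \<open>u \<in> _\<close> \<open>v \<in> _\<close> show ?case by (simp add: stuffle_word_assoc)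
    qed (simp_all add: stuffle_simps)
  qed (simp_all add: stuffle_simps)
qed (simp_all add: stuffle_simps)

section \<open>The Leibniz rule\<close>

lemma last_deriv_conc:
  assumes "Poly_Mapping.keys L \<subseteq> singletons UNIV"
  shows "last_deriv (conc p L) = conc p (last_deriv L)"
  using assms
proof (induction L rule: elt_induct)
  case (word v)
  have "Poly_Mapping.keys p \<subseteq> UNIV" by simp
  then show ?case
    by (induction p rule: elt_induct)
      (use word in \<open>auto simp: conc_simps last_deriv_simps\<close>)
qed (simp_all add: conc_simps last_deriv_simps)

lemma conc_one [simp]: "conc p (word []) = p"
proof -
  have "Poly_Mapping.keys p \<subseteq> UNIV" by simp
  then show ?thesis by (induction p rule: elt_induct) (simp_all add: conc_simps)
qed

text \<open>In the recursion \<open>last_deriv\<close> strips the last letters of the first two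
  terms, which gives the two Leibniz terms, and it kills the third by
  \<open>last_deriv_letter_odot\<close>.\<close>

lemma last_deriv_stuffle_word:
  assumes "u \<in> lists letters" "v \<in> lists letters"
  shows "last_deriv (stuffle \<mu> (word u) (word v)) =
    stuffle \<mu> (last_deriv (word u)) (word v) + stuffle \<mu> (word u) (last_deriv (word v))"
proof -
  consider "u = []" | "v = []" | u' x v' y where "u = u' @ [x]" "v = v' @ [y]"
    by (metis rev_exhaust)
  then show ?thesis
  proof cases
    case 3
    have xy: "x \<in> letters" "y \<in> letters" using assms 3 by auto
    have "Poly_Mapping.keys (letter_odot x y) \<subseteq> singletons UNIV"
      using keys_letter_odot[OF xy] by blast
    then have "last_deriv (conc p (letter_odot x y)) = 0" for p
      by (simp add: last_deriv_conc last_deriv_letter_odot[OF xy] conc_simps)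
    moreover have "last_deriv (conc p (word [a])) = (if fst a = 1 then p else 0)" for p a
      by (simp add: last_deriv_conc conc_simps)
    ultimately show ?thesis
      by (simp add: 3 stuffle_simps stuffle_word_snoc last_deriv_simps)
  qed (simp_all add: stuffle_simps stuffle_word_Nil)
qed

lemma last_deriv_stuffle:
  assumes "Poly_Mapping.keys p \<subseteq> lists letters" "Poly_Mapping.keys q \<subseteq> lists letters"
  shows "last_deriv (stuffle \<mu> p q) = stuffle \<mu> (last_deriv p) q + stuffle \<mu> p (last_deriv q)"
  using assms(1)
proof (induction p rule: elt_induct)
  case (word u)
  from assms(2) show ?case
  proof (induction q rule: elt_induct)
    case (word v)
    with \<open>u \<in> _\<close> show ?case by (rule last_deriv_stuffle_word)
  qed (simp_all add: stuffle_simps last_deriv_simps scale_add_right algebra_simps)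
qed (simp_all add: stuffle_simps last_deriv_simps scale_add_right algebra_simps)

section \<open>Closure properties of \<open>QY\<close>\<close>

lemma Qadj_of_rat: "of_rat a \<in> Qadj \<mu>"
  unfolding Qadj_def by (rule image_eqI[of _ _ "[:a:]"]) (simp_all add: map_poly_pCons)

lemma Qadj_0: "0 \<in> Qadj \<mu>" and Qadj_1: "1 \<in> Qadj \<mu>"
  using Qadj_of_rat[of 0] Qadj_of_rat[of 1] by simp_all

lemma Qadj_mu: "\<mu> \<in> Qadj \<mu>"
  unfolding Qadj_def by (rule image_eqI[of _ _ "[:0, 1:]"]) (simp_all add: map_poly_pCons)

lemma Qadj_add:
  assumes "a \<in> Qadj \<mu>" "b \<in> Qadj \<mu>"
  shows "a + b \<in> Qadj \<mu>"
proof -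
  have "map_poly of_rat (p + q) = map_poly of_rat p + (map_poly of_rat q :: complex poly)" for p q
    by (rule poly_eqI) (simp add: coeff_map_poly of_rat_add)
  then have "poly (map_poly of_rat p) \<mu> + poly (map_poly of_rat q) \<mu> =
      poly (map_poly of_rat (p + q)) \<mu>" for p q
    by simp
  then show ?thesis
    using assms unfolding Qadj_def by blast
qed

lemma Qadj_mult:
  assumes "a \<in> Qadj \<mu>" "b \<in> Qadj \<mu>"
  shows "a * b \<in> Qadj \<mu>"
proof -
  have "map_poly of_rat (p * q) = map_poly of_rat p * (map_poly of_rat q :: complex poly)" for p q
    by (rule poly_eqI) (simp add: coeff_map_poly coeff_mult of_rat_sum of_rat_mult)
  then have "poly (map_poly of_rat p) \<mu> * poly (map_poly of_rat q) \<mu> =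
      poly (map_poly of_rat (p * q)) \<mu>" for p q
    by simp
  then show ?thesis
    using assms unfolding Qadj_def by blast
qed

lemma QY_keys: "p \<in> QY \<mu> \<Longrightarrow> Poly_Mapping.keys p \<subseteq> lists letters"
  and QY_lookup: "p \<in> QY \<mu> \<Longrightarrow> Poly_Mapping.lookup p w \<in> Qadj \<mu>"
  by (simp_all add: QY_def)

lemma QY_zero: "0 \<in> QY \<mu>"
  by (simp add: QY_def Qadj_0)

lemma QY_word: "w \<in> lists letters \<Longrightarrow> word w \<in> QY \<mu>"
  by (simp add: QY_def lookup_word Qadj_0 Qadj_1)

lemma QY_add: "p \<in> QY \<mu> \<Longrightarrow> q \<in> QY \<mu> \<Longrightarrow> p + q \<in> QY \<mu>"
  by (simp add: QY_def keys_subset_add lookup_add Qadj_add)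

lemma QY_scale: "c \<in> Qadj \<mu> \<Longrightarrow> p \<in> QY \<mu> \<Longrightarrow> scale c p \<in> QY \<mu>"
  by (simp add: QY_def keys_subset_scale Qadj_mult)

lemma Qadj_minus_one: "- 1 \<in> Qadj \<mu>"
  using Qadj_of_rat[of "- 1"] by (simp add: of_rat_minus)

lemma QY_diff: "p \<in> QY \<mu> \<Longrightarrow> q \<in> QY \<mu> \<Longrightarrow> p - q \<in> QY \<mu>"
  unfolding diff_eq_add_scale by (intro QY_add QY_scale Qadj_minus_one)

lemma QY_sum: "(\<And>i. i \<in> I \<Longrightarrow> f i \<in> QY \<mu>) \<Longrightarrow> sum f I \<in> QY \<mu>"
  by (induction I rule: infinite_finite_induct) (simp_all add: QY_zero QY_add)

lemma QY_lin:
  "p \<in> QY \<mu> \<Longrightarrow> (\<And>u. u \<in> lists letters \<Longrightarrow> f u \<in> QY \<mu>) \<Longrightarrow> lin f p \<in> QY \<mu>"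
  unfolding lin_def by (intro QY_sum QY_scale QY_lookup) (use QY_keys in blast)+

lemma QY_bilin:
  "p \<in> QY \<mu> \<Longrightarrow> q \<in> QY \<mu> \<Longrightarrow>
    (\<And>u v. u \<in> lists letters \<Longrightarrow> v \<in> lists letters \<Longrightarrow> f u v \<in> QY \<mu>) \<Longrightarrow> bilin f p q \<in> QY \<mu>"
  unfolding bilin_eq_lin by (intro QY_lin)

lemma QY_conc: "p \<in> QY \<mu> \<Longrightarrow> q \<in> QY \<mu> \<Longrightarrow> conc p q \<in> QY \<mu>"
  unfolding conc_def by (intro QY_bilin QY_word) auto

lemma QY_letter_odot:
  assumes "x \<in> letters" "y \<in> letters"
  shows "letter_odot x y \<in> QY \<mu>"
proof -
  have "(i, snd x) \<in> letters" "(i, snd y) \<in> letters" if "i \<ge> 1" for i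
    using assms that by (auto simp: letters_def)
  moreover have "fst x + fst y \<ge> 1" using assms by (auto simp: letters_def)
  ultimately show ?thesis
    unfolding letter_odot_def
    by (auto intro!: QY_add QY_sum QY_scale QY_word Qadj_of_rat)
qed

text \<open>The only scalars that the recursion introduces are \<open>\<mu>\<close> and the rational
  coefficients of partial fractions, all in \<open>Qadj \<mu>\<close>.\<close>

lemma QY_stuffle_word:
  "u \<in> lists letters \<Longrightarrow> v \<in> lists letters \<Longrightarrow> stuffle_word \<mu> u v \<in> QY \<mu>"
proof (induction "length u + length v" arbitrary: u v rule: less_induct)
  case less
  consider "u = []" | "v = []" | u' x v' y where "u = u' @ [x]" "v = v' @ [y]"
    by (metis rev_exhaust)
  then show ?case
  proof cases
    case 3
    have "stuffle_word \<mu> u' v \<in> QY \<mu>" "stuffle_word \<mu> u v' \<in> QY \<mu>" "stuffle_word \<mu> u' v' \<in> QY \<mu>"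
      using less.prems 3 by (auto intro!: less.hyps)
    moreover have "x \<in> letters" "y \<in> letters" using less.prems 3 by auto
    ultimately show ?thesis
      unfolding 3 stuffle_word_snoc
      by (intro QY_diff QY_add QY_conc QY_scale QY_word QY_letter_odot Qadj_mu) auto
  qed (use less.prems in \<open>simp_all add: stuffle_word_Nil QY_word\<close>)
qed

lemma QY_stuffle: "p \<in> QY \<mu> \<Longrightarrow> q \<in> QY \<mu> \<Longrightarrow> stuffle \<mu> p q \<in> QY \<mu>"
  unfolding stuffle_def by (intro QY_bilin QY_stuffle_word)

lemma QY_last_deriv: "p \<in> QY \<mu> \<Longrightarrow> last_deriv p \<in> QY \<mu>"
  unfolding last_deriv_def
  by (intro QY_lin) (auto intro!: QY_word QY_zero dest: in_set_butlastD simp: lists_eq_set subset_iff)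

section \<open>The kernel of the derivation\<close>

lemma Qadj_spanI: "g \<in> G \<Longrightarrow> c \<in> Qadj \<mu> \<Longrightarrow> scale c g \<in> Qadj_span \<mu> G"
  unfolding Qadj_span_def by (intro CollectI exI[of _ "{g}"] exI[of _ "\<lambda>_. c"]) auto

lemma Qadj_span_zero: "0 \<in> Qadj_span \<mu> G"
  unfolding Qadj_span_def by (intro CollectI exI[of _ "{}"]) auto

lemma Qadj_span_add:
  assumes "p \<in> Qadj_span \<mu> G" "q \<in> Qadj_span \<mu> G"
  shows "p + q \<in> Qadj_span \<mu> G"
proof -
  obtain S c T d where S: "finite S" "S \<subseteq> G" "c ` S \<subseteq> Qadj \<mu>" "p = (\<Sum>g\<in>S. scale (c g) g)"
    and T: "finite T" "T \<subseteq> G" "d ` T \<subseteq> Qadj \<mu>" "q = (\<Sum>g\<in>T. scale (d g) g)"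
    using assms unfolding Qadj_span_def by blast
  \<comment> \<open>Extension by 0 puts both coefficient functions on the union of the two
    supports.\<close>
  define c' where "c' g = (if g \<in> S then c g else 0)" for g
  define d' where "d' g = (if g \<in> T then d g else 0)" for g
  have "p = (\<Sum>g\<in>S \<union> T. scale (c' g) g)"
    unfolding S(4) using S(1) T(1) by (intro sum.mono_neutral_cong_left) (auto simp: c'_def)
  moreover have "q = (\<Sum>g\<in>S \<union> T. scale (d' g) g)"
    unfolding T(4) using S(1) T(1) by (intro sum.mono_neutral_cong_left) (auto simp: d'_def)
  ultimately have "p + q = (\<Sum>g\<in>S \<union> T. scale (c' g + d' g) g)"
    by (simp add: scale_add_left sum.distrib)
  moreover have "c' g + d' g \<in> Qadj \<mu>" for g
    using S(3) T(3) by (intro Qadj_add) (auto simp: c'_def d'_def Qadj_0)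
  ultimately show ?thesis
    using S T unfolding Qadj_span_def
    by (intro CollectI exI[of _ "S \<union> T"] exI[of _ "\<lambda>g. c' g + d' g"]) auto
qed

lemma last_deriv_sum: "last_deriv (sum f I) = (\<Sum>i\<in>I. last_deriv (f i))"
  by (induction I rule: infinite_finite_induct) (simp_all add: last_deriv_simps)

text \<open>A nonempty admissible word has last index above 1, and the two words of a
  quasi-admissible element leave the same prefix, which cancels.\<close>

lemma generators_in_kernel:
  assumes "g \<in> admissible \<union> quasi_admissible"
  shows "g \<in> QY \<mu>" "last_deriv g = 0"
  using assms
  by (auto simp: admissible_def quasi_admissible_def conc_simps last_deriv_simps
      intro!: QY_word QY_diff)

text \<open>With (1, 1) as reference letter, the unscaled difference is the word itself if it is
  admissible, 0 if it ends in the reference letter, and quasi-admissible otherwise.\<close>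

lemma scaled_word_minus_conc_in_QY0:
  assumes "w \<in> lists letters" "c \<in> Qadj \<mu>"
  shows "scale c (word w) - conc (last_deriv (scale c (word w))) (word [(1, 1)]) \<in> QY0 \<mu>"
proof -
  define t where "t = word w - conc (last_deriv (word w)) (word [(1, 1)])"
  have "t = 0 \<or> t \<in> admissible \<union> quasi_admissible"
  proof (cases w rule: rev_cases)
    case Nil
    then show ?thesis by (simp add: t_def admissible_def conc_simps)
  next
    case (snoc u x)
    obtain k m where x: "x = (k, m)" by fastforce
    have km: "(k, m) \<in> letters" "u \<in> lists letters" using assms(1) by (auto simp: snoc x)
    consider "k > 1" | "k = 1" "m = 1" | "k = 1" "m \<noteq> 1"
      using km by (force simp: letters_def)
    then show ?thesis
    proof cases
      case 1
      then have "t = word (u @ [(k, m)])" by (simp add: t_def snoc x conc_simps)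
      with 1 km show ?thesis unfolding admissible_def by blast
    next
      case 2
      then show ?thesis by (simp add: t_def snoc x conc_simps)
    next
      case 3
      then have "t = conc (word u) (word [(1, m)] - word [(1, 1)])"
        by (simp add: t_def snoc x conc_simps)
      moreover have "(1, 1) \<in> letters" by (simp add: letters_def)
      ultimately show ?thesis
        using 3 km unfolding quasi_admissible_def by blast
    qed
  qed
  then have "scale c t \<in> QY0 \<mu>"
    unfolding QY0_def using assms(2) by (auto intro: Qadj_spanI Qadj_span_zero)
  then show ?thesis
    by (simp add: t_def scale_diff_right last_deriv_simps conc_simps del: last_deriv_word)
qed

text \<open>Subtracting \<open>conc (last_deriv p) (word [(1, 1)])\<close> from \<open>p\<close>
  changes nothing on the kernel, and by linearity it sends all of \<open>QY \<mu>\<close> into the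
  span.\<close>

lemma QY0_eq_kernel: "QY0 \<mu> = {p \<in> QY \<mu>. last_deriv p = 0}"
proof
  show "QY0 \<mu> \<subseteq> {p \<in> QY \<mu>. last_deriv p = 0}"
    unfolding QY0_def Qadj_span_def
    using generators_in_kernel
    by (fastforce intro!: QY_sum QY_scale sum.neutral simp: last_deriv_sum last_deriv_simps)
next
  show "{p \<in> QY \<mu>. last_deriv p = 0} \<subseteq> QY0 \<mu>"
  proof
    fix p assume p: "p \<in> {p \<in> QY \<mu>. last_deriv p = 0}"
    then have "Poly_Mapping.keys p \<subseteq> lists letters" using QY_keys by blast
    \<comment> \<open>The words of \<open>p\<close> need not lie in the kernel one by one, so the
      induction is run on a claim that makes sense for each of them.\<close>
    then have "p - conc (last_deriv p) (word [(1, 1)]) \<in> QY0 \<mu>"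
    proof (induction p rule: elt_induct_scaled)
      case zero
      then show ?case by (simp add: QY0_def last_deriv_simps conc_simps Qadj_span_zero)
    next
      case (scaled w)
      then show ?case using p by (intro scaled_word_minus_conc_in_QY0) (auto simp: QY_lookup)
    next
      case (add q r)
      then show ?case
        using Qadj_span_add unfolding QY0_def by (fastforce simp: last_deriv_simps conc_simps algebra_simps)
    qed
    then show "p \<in> QY0 \<mu>" using p by (simp add: conc_simps)
  qed
qed

section \<open>The stuffle algebra and the slice theorem\<close>

lemma stuffle_algebra_simps [simp]:
  "carrier (stuffle_algebra \<mu>) = QY \<mu>" "mult (stuffle_algebra \<mu>) = stuffle \<mu>"
  "one (stuffle_algebra \<mu>) = word []" "zero (stuffle_algebra \<mu>) = 0"
  "add (stuffle_algebra \<mu>) = (+)" "smult (stuffle_algebra \<mu>) = stuffle \<mu>"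
  "carrier (stuffle_algebra0 \<mu>) = QY0 \<mu>" "mult (stuffle_algebra0 \<mu>) = stuffle \<mu>"
  "one (stuffle_algebra0 \<mu>) = word []" "zero (stuffle_algebra0 \<mu>) = 0"
  "add (stuffle_algebra0 \<mu>) = (+)"
  by (simp_all add: stuffle_algebra_def stuffle_algebra0_def)

lemma QY0_imp_QY: "p \<in> QY0 \<mu> \<Longrightarrow> p \<in> QY \<mu>"
  by (simp add: QY0_eq_kernel)

lemma QY0_zero: "0 \<in> QY0 \<mu>"
  by (simp add: QY0_eq_kernel QY_zero last_deriv_simps)

lemma QY0_one: "word [] \<in> QY0 \<mu>"
  by (simp add: QY0_eq_kernel QY_word)

lemma QY0_add: "p \<in> QY0 \<mu> \<Longrightarrow> q \<in> QY0 \<mu> \<Longrightarrow> p + q \<in> QY0 \<mu>"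
  by (simp add: QY0_eq_kernel QY_add last_deriv_simps)

lemma QY0_scale: "c \<in> Qadj \<mu> \<Longrightarrow> p \<in> QY0 \<mu> \<Longrightarrow> scale c p \<in> QY0 \<mu>"
  by (simp add: QY0_eq_kernel QY_scale last_deriv_simps)

lemma QY0_diff: "p \<in> QY0 \<mu> \<Longrightarrow> q \<in> QY0 \<mu> \<Longrightarrow> p - q \<in> QY0 \<mu>"
  by (simp add: QY0_eq_kernel QY_diff last_deriv_simps)

lemma QY_last_deriv_stuffle:
  "p \<in> QY \<mu> \<Longrightarrow> q \<in> QY \<mu> \<Longrightarrow>
    last_deriv (stuffle \<mu> p q) = stuffle \<mu> (last_deriv p) q + stuffle \<mu> p (last_deriv q)"
  by (intro last_deriv_stuffle QY_keys)

text \<open>The kernel of a derivation is closed under products.\<close>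

lemma QY0_stuffle: "p \<in> QY0 \<mu> \<Longrightarrow> q \<in> QY0 \<mu> \<Longrightarrow> stuffle \<mu> p q \<in> QY0 \<mu>"
  by (simp add: QY0_eq_kernel QY_stuffle QY_last_deriv_stuffle stuffle_simps)

lemma QY_stuffle_assoc:
  "p \<in> QY \<mu> \<Longrightarrow> q \<in> QY \<mu> \<Longrightarrow> r \<in> QY \<mu> \<Longrightarrow>
    stuffle \<mu> (stuffle \<mu> p q) r = stuffle \<mu> p (stuffle \<mu> q r)"
  by (intro stuffle_assoc QY_keys)

lemma QY_stuffle_commute: "p \<in> QY \<mu> \<Longrightarrow> q \<in> QY \<mu> \<Longrightarrow> stuffle \<mu> p q = stuffle \<mu> q p"
  by (intro stuffle_commute QY_keys)

lemma cring_stuffle_algebra: "cring (stuffle_algebra \<mu>)"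
proof (rule cringI)
  have "\<exists>q\<in>QY \<mu>. q + p = 0" if "p \<in> QY \<mu>" for p
    using QY_diff[OF QY_zero that] by (intro bexI[of _ "0 - p"]) simp_all
  then show "abelian_group (stuffle_algebra \<mu>)"
    by (intro abelian_groupI) (simp_all add: QY_add QY_zero algebra_simps)
  show "comm_monoid (stuffle_algebra \<mu>)"
    by (intro comm_monoidI)
      (simp_all add: QY_stuffle QY_word QY_stuffle_assoc, rule QY_stuffle_commute)
qed (simp add: stuffle_simps)

lemma cring_stuffle_algebra0: "cring (stuffle_algebra0 \<mu>)"
proof (rule cringI)
  have "\<exists>q\<in>QY0 \<mu>. q + p = 0" if "p \<in> QY0 \<mu>" for p
    using QY0_diff[OF QY0_zero that] by (intro bexI[of _ "0 - p"]) simp_all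
  then show "abelian_group (stuffle_algebra0 \<mu>)"
    by (intro abelian_groupI) (simp_all add: QY0_add QY0_zero algebra_simps)
  show "comm_monoid (stuffle_algebra0 \<mu>)"
    by (intro comm_monoidI)
      (simp_all add: QY0_stuffle QY0_one QY_stuffle_assoc QY0_imp_QY,
        intro QY_stuffle_commute QY0_imp_QY)
qed (simp add: stuffle_simps)

lemma algebra_stuffle_algebra: "algebra (stuffle_algebra0 \<mu>) (stuffle_algebra \<mu>)"
  by (rule algebraI[OF cring_stuffle_algebra0 cring_stuffle_algebra])
    (simp_all add: QY_stuffle QY0_imp_QY stuffle_simps QY_stuffle_assoc)

lemma finsum_stuffle_algebra:
  assumes "finite I" "\<And>i. i \<in> I \<Longrightarrow> f i \<in> QY \<mu>"
  shows "(\<Oplus>\<^bsub>stuffle_algebra \<mu>\<^esub>i\<in>I. f i) = sum f I"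
proof -
  interpret cring "stuffle_algebra \<mu>" by (rule cring_stuffle_algebra)
  show ?thesis
    using assms
    by (induction I rule: finite_induct) (simp_all add: finsum_insert Pi_def finsum_empty[simplified])
qed

text \<open>Each application shortens every word that it does not kill. At \<open>n = 0\<close> the
  support is empty.\<close>

lemma funpow_last_deriv_eq_0:
  "Poly_Mapping.keys p \<subseteq> {w. length w < n} \<Longrightarrow> (last_deriv ^^ n) p = 0"
proof (induction n arbitrary: p)
  case (Suc n)
  have "length (butlast u) < n" if "u \<noteq> []" "u \<in> Poly_Mapping.keys p" for u
    using Suc.prems that by (cases u) auto
  then have "Poly_Mapping.keys (last_deriv p) \<subseteq> {w. length w < n}"
    unfolding last_deriv_def by (intro keys_subset_lin) simp
  then show ?case by (simp add: Suc.IH funpow_Suc_right del: funpow.simps)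
qed simp

lemma last_deriv_nilpotent: "\<exists>n. (last_deriv ^^ n) p = 0"
proof
  \<comment> \<open>The length bound is strict, hence the successor of the maximal length.\<close>
  show "(last_deriv ^^ Suc (Max (length ` Poly_Mapping.keys p))) p = 0"
    by (rule funpow_last_deriv_eq_0) (auto simp: less_Suc_eq_le)
qed

text \<open>The slice is \<open>word [(1, m)]\<close>, which \<open>last_deriv\<close> sends to the
  unit; the assumption makes (1, m) a letter.\<close>

locale slice =
  fixes \<mu> :: complex and m :: rat
  assumes m: "m > 0"
begin

section \<open>Powers of the slice and polynomials in it\<close>

abbreviation pow :: "nat \<Rightarrow> elt" where
  "pow i \<equiv> word [(1, m)] [^]\<^bsub>stuffle_algebra \<mu>\<^esub> i"

lemma slice_in_QY: "word [(1, m)] \<in> QY \<mu>"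
  using m by (intro QY_word) (simp add: letters_def)

interpretation A: cring "stuffle_algebra \<mu>"
  by (rule cring_stuffle_algebra)

lemma pow_0: "pow 0 = word []"
  by simp

lemma pow_Suc: "pow (Suc i) = stuffle \<mu> (pow i) (word [(1, m)])"
  by simp

lemma pow_in_QY: "pow i \<in> QY \<mu>"
  using A.nat_pow_closed[of "word [(1, m)]" i] slice_in_QY by simp

text \<open>The power rule, from the Leibniz rule and the slice having derivative 1.\<close>

lemma last_deriv_pow: "last_deriv (pow (Suc i)) = scale (of_nat (Suc i)) (pow i)"
proof (induction i)
  case (Suc i)
  have "last_deriv (pow (Suc (Suc i))) =
      stuffle \<mu> (scale (of_nat (Suc i)) (pow i)) (word [(1, m)]) + pow (Suc i)"
    unfolding pow_Suc[of "Suc i"] QY_last_deriv_stuffle[OF pow_in_QY slice_in_QY]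
      Suc.IH by simp
  also have "\<dots> = scale (of_nat (Suc (Suc i))) (pow (Suc i))"
    unfolding stuffle_simps pow_Suc[symmetric] of_nat_Suc[of "Suc i"] scale_add_left scale_one
    by (rule add.commute)
  finally show ?case .
qed simp

text \<open>A polynomial of degree below \<open>n\<close> evaluated at the slice. The explicit bound
  allows induction on \<open>n\<close>, differentiating once per step.\<close>

definition power_sum :: "nat \<Rightarrow> (nat \<Rightarrow> elt) \<Rightarrow> elt" where
  "power_sum n a = (\<Sum>i<n. stuffle \<mu> (a i) (pow i))"

lemma power_sum_Suc: "power_sum (Suc n) a = a 0 + (\<Sum>i<n. stuffle \<mu> (a (Suc i)) (pow (Suc i)))"
  unfolding power_sum_def sum.lessThan_Suc_shift pow_0 stuffle_one ..

text \<open>Coefficients in \<open>QY0 \<mu>\<close> are constants of the derivation, so it acts as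
  the formal derivative in the slice.\<close>

lemma last_deriv_power_sum:
  assumes "\<And>i. a i \<in> QY0 \<mu>"
  shows "last_deriv (\<Sum>i<n. stuffle \<mu> (a i) (pow (Suc i))) =
    power_sum n (\<lambda>i. scale (of_nat (Suc i)) (a i))"
proof -
  have "last_deriv (stuffle \<mu> (a i) (pow (Suc i))) = stuffle \<mu> (scale (of_nat (Suc i)) (a i)) (pow i)" for i
    using assms[of i]
    by (simp only: QY_last_deriv_stuffle pow_in_QY QY0_imp_QY last_deriv_pow)
      (simp add: QY0_eq_kernel stuffle_simps)
  then show ?thesis by (simp only: last_deriv_sum power_sum_def)
qed

text \<open>Differentiating a relation gives a shorter one between the multiples
  \<open>Suc i\<close> of the higher coefficients, which vanish by induction; then only the constant
  term is left.\<close>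

lemma power_sum_eq_0:
  "(\<And>i. a i \<in> QY0 \<mu>) \<Longrightarrow> power_sum n a = 0 \<Longrightarrow> i < n \<Longrightarrow> a i = 0"
proof (induction n arbitrary: a i)
  case (Suc n)
  have "last_deriv (power_sum (Suc n) a) = power_sum n (\<lambda>i. scale (of_nat (Suc i)) (a (Suc i)))"
    using Suc.prems(1)[of 0] last_deriv_power_sum[of "\<lambda>i. a (Suc i)" n] Suc.prems(1)
    unfolding power_sum_Suc by (simp add: last_deriv_simps QY0_eq_kernel del: A.nat_pow_Suc)
  then have *: "power_sum n (\<lambda>i. scale (of_nat (Suc i)) (a (Suc i))) = 0"
    using Suc.prems(2) by (simp add: last_deriv_simps)
  have a: "a (Suc j) = 0" if "j < n" for j
  proof -
    have "scale (of_nat (Suc j)) (a (Suc j)) = 0"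
      using Suc.IH[OF _ * that] Suc.prems(1) Qadj_of_rat[of "of_nat (Suc _)"]
      by (auto intro!: QY0_scale simp del: of_nat_Suc)
    \<comment> \<open>The positive integer factor is divided out, as the scalars contain the
      rationals.\<close>
    from arg_cong[OF this, of "scale (1 / of_nat (Suc j))"] show ?thesis
      by (simp del: of_nat_Suc)
  qed
  then have "a 0 = 0"
    using Suc.prems(2) by (simp add: power_sum_Suc stuffle_simps del: A.nat_pow_Suc)
  with a show ?case using Suc.prems(3) by (cases i) auto
qed simp

text \<open>Formal integration: by induction the derivative of \<open>p\<close> is a polynomial in
  the slice. Its antiderivative \<open>q\<close> differs from \<open>p\<close> by an element of the
  kernel, which becomes the constant term.\<close>

lemma power_sum_surj:
  "p \<in> QY \<mu> \<Longrightarrow> (last_deriv ^^ n) p = 0 \<Longrightarrow> \<exists>a. (\<forall>i. a i \<in> QY0 \<mu>) \<and> p = power_sum n a"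
proof (induction n arbitrary: p)
  case 0
  then show ?case by (intro exI[of _ "\<lambda>_. 0"]) (simp add: power_sum_def QY0_zero)
next
  case (Suc n)
  have "(last_deriv ^^ n) (last_deriv p) = 0"
    using Suc.prems(2) by (simp add: funpow_Suc_right del: funpow.simps)
  then obtain b where b: "\<And>i. b i \<in> QY0 \<mu>" "last_deriv p = power_sum n b"
    using Suc.IH QY_last_deriv[OF Suc.prems(1)] by blast
  \<comment> \<open>Coefficients of the antiderivative; the rational factor keeps them in
    \<open>QY0 \<mu>\<close>.\<close>
  define c where "c i = scale (1 / of_nat (Suc i)) (b i)" for i
  have c: "c i \<in> QY0 \<mu>" for i
    using b(1) Qadj_of_rat[of "1 / of_nat (Suc i)"] unfolding c_def
    by (intro QY0_scale) (simp_all add: of_rat_divide del: of_nat_Suc)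
  define q where "q = (\<Sum>i<n. stuffle \<mu> (c i) (pow (Suc i)))"
  have "last_deriv q = last_deriv p"
    unfolding q_def last_deriv_power_sum[OF c] b(2) by (simp add: c_def del: of_nat_Suc)
  moreover have "q \<in> QY \<mu>"
    unfolding q_def by (intro QY_sum QY_stuffle pow_in_QY QY0_imp_QY c)
  ultimately have "p - q \<in> QY0 \<mu>"
    using Suc.prems(1) by (simp add: QY0_eq_kernel QY_diff last_deriv_simps)
  moreover have "p = power_sum (Suc n) (case_nat (p - q) c)"
    unfolding power_sum_Suc nat.case q_def[symmetric] by simp
  ultimately show ?case
    using c by (intro exI[of _ "case_nat (p - q) c"]) (auto split: nat.split)
qed

section \<open>The map \<open>psi\<close> as an evaluation homomorphism\<close>

interpretation UP_cring "stuffle_algebra0 \<mu>" "UP (stuffle_algebra0 \<mu>)"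
  by (intro UP_cring.intro cring_stuffle_algebra0)

interpretation UP_pre_univ_prop "stuffle_algebra0 \<mu>" "stuffle_algebra \<mu>" "\<lambda>p. p" "UP (stuffle_algebra0 \<mu>)"
  by (intro UP_pre_univ_prop.intro ring_hom_cring.intro ring_hom_cring_axioms.intro UP_cring_axioms
      cring_stuffle_algebra0 cring_stuffle_algebra ring_hom_memI)
    (simp_all add: QY0_imp_QY)

text \<open>With the inclusion of \<open>QY0 \<mu>\<close> into \<open>QY \<mu>\<close> as
  coefficient map, \<open>psi\<close> is the evaluation of the universal property, which supplies
  the homomorphism laws.\<close>

lemma psi_eq_eval:
  "p \<in> carrier (UP (stuffle_algebra0 \<mu>)) \<Longrightarrow>
    psi \<mu> m p = eval (stuffle_algebra0 \<mu>) (stuffle_algebra \<mu>) (\<lambda>p. p) (word [(1, m)]) p"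
  by (simp add: psi_def eval_on_carrier)

lemma psi_ring_hom: "psi \<mu> m \<in> ring_hom (UP (stuffle_algebra0 \<mu>)) (stuffle_algebra \<mu>)"
proof -
  have hom: "eval (stuffle_algebra0 \<mu>) (stuffle_algebra \<mu>) (\<lambda>p. p) (word [(1, m)])
      \<in> ring_hom (UP (stuffle_algebra0 \<mu>)) (stuffle_algebra \<mu>)"
    by (rule eval_ring_hom) (use slice_in_QY in simp)
  show ?thesis
    by (rule ring_hom_memI)
      (simp_all only: psi_eq_eval P.a_closed P.m_closed P.one_closed ring_hom_closed[OF hom]
        ring_hom_add[OF hom] ring_hom_mult[OF hom] ring_hom_one[OF hom])
qed

lemma coeff_in_QY0:
  "p \<in> carrier (UP (stuffle_algebra0 \<mu>)) \<Longrightarrow> coeff (UP (stuffle_algebra0 \<mu>)) p i \<in> QY0 \<mu>"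
  using coeff_closed by simp

text \<open>Coefficients beyond the degree vanish, so any larger bound serves; several polynomials
  can then share one bound.\<close>

lemma psi_eq_power_sum:
  assumes p: "p \<in> carrier (UP (stuffle_algebra0 \<mu>))" and "deg (stuffle_algebra0 \<mu>) p < n"
  shows "psi \<mu> m p = power_sum n (coeff (UP (stuffle_algebra0 \<mu>)) p)"
proof -
  have "stuffle \<mu> (coeff (UP (stuffle_algebra0 \<mu>)) p i) (pow i) \<in> QY \<mu>" for i
    by (intro QY_stuffle pow_in_QY QY0_imp_QY coeff_in_QY0 p)
  then have "psi \<mu> m p =
      (\<Sum>i\<le>deg (stuffle_algebra0 \<mu>) p. stuffle \<mu> (coeff (UP (stuffle_algebra0 \<mu>)) p i) (pow i))"
    unfolding psi_def stuffle_algebra_simps by (intro finsum_stuffle_algebra) simp_all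
  also have "\<dots> = power_sum n (coeff (UP (stuffle_algebra0 \<mu>)) p)"
    unfolding power_sum_def using assms(2) deg_aboveD[OF _ p]
    by (intro sum.mono_neutral_left) (auto simp: stuffle_simps)
  finally show ?thesis .
qed

lemma psi_inj: "inj_on (psi \<mu> m) (carrier (UP (stuffle_algebra0 \<mu>)))"
proof (rule inj_onI)
  let ?c = "coeff (UP (stuffle_algebra0 \<mu>))"
  fix p q
  assume p: "p \<in> carrier (UP (stuffle_algebra0 \<mu>))" and q: "q \<in> carrier (UP (stuffle_algebra0 \<mu>))"
    and eq: "psi \<mu> m p = psi \<mu> m q"
  show "p = q"
  proof (rule up_eqI[OF _ p q])
    fix i
    \<comment> \<open>Exceeds both degrees and the index \<open>i\<close> whose coefficients are
      compared.\<close>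
    define n where "n = Suc (i + deg (stuffle_algebra0 \<mu>) p + deg (stuffle_algebra0 \<mu>) q)"
    have "power_sum n (?c p) = power_sum n (?c q)"
      using eq psi_eq_power_sum[OF p, of n] psi_eq_power_sum[OF q, of n] by (simp add: n_def)
    then have "power_sum n (\<lambda>i. ?c p i - ?c q i) = 0"
      by (simp add: power_sum_def stuffle_simps sum_subtractf)
    then have "?c p i - ?c q i = 0"
      by (rule power_sum_eq_0[rotated]) (auto simp: n_def intro!: QY0_diff coeff_in_QY0 p q)
    then show "?c p i = ?c q i" by simp
  qed
qed

lemma psi_surj: "QY \<mu> \<subseteq> psi \<mu> m ` carrier (UP (stuffle_algebra0 \<mu>))"
proof
  fix p assume p: "p \<in> QY \<mu>"
  obtain n a where a: "\<And>i. a i \<in> QY0 \<mu>" "p = power_sum n a"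
    using last_deriv_nilpotent power_sum_surj[OF p] by metis
  \<comment> \<open>The sequence \<open>a\<close> may go on beyond \<open>n\<close>, whereas a
    polynomial has finite support.\<close>
  define b where "b i = (if i < n then a i else 0)" for i
  have b: "b \<in> up (stuffle_algebra0 \<mu>)"
    by (rule mem_upI) (auto simp: b_def a QY0_zero intro!: exI[of _ n] bound.intro)
  then have bP: "b \<in> carrier (UP (stuffle_algebra0 \<mu>))" by (simp add: UP_def)
  have coeff: "coeff (UP (stuffle_algebra0 \<mu>)) b = b" using b by (simp add: UP_def)
  define N where "N = Suc (n + deg (stuffle_algebra0 \<mu>) b)"
  have "psi \<mu> m b = power_sum N b"
    using psi_eq_power_sum[OF bP, of N] by (simp add: coeff N_def)
  also have "\<dots> = power_sum n a"
    unfolding power_sum_def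
    by (intro sum.mono_neutral_cong_right) (auto simp: N_def b_def stuffle_simps)
  finally show "p \<in> psi \<mu> m ` carrier (UP (stuffle_algebra0 \<mu>))"
    using a(2) bP by (intro image_eqI[of _ _ b]) simp_all
qed

text \<open>Coefficient by coefficient this is associativity of the product.\<close>

lemma psi_smult:
  assumes "a \<in> QY0 \<mu>" and p: "p \<in> carrier (UP (stuffle_algebra0 \<mu>))"
  shows "psi \<mu> m (a \<odot>\<^bsub>UP (stuffle_algebra0 \<mu>)\<^esub> p) = stuffle \<mu> a (psi \<mu> m p)"
proof -
  let ?q = "a \<odot>\<^bsub>UP (stuffle_algebra0 \<mu>)\<^esub> p" and ?c = "coeff (UP (stuffle_algebra0 \<mu>))"
  have q: "?q \<in> carrier (UP (stuffle_algebra0 \<mu>))"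
    using assms by (intro UP_smult_closed) simp_all
  define n where "n = Suc (deg (stuffle_algebra0 \<mu>) p + deg (stuffle_algebra0 \<mu>) ?q)"
  have "stuffle \<mu> (?c ?q i) (pow i) = stuffle \<mu> a (stuffle \<mu> (?c p i) (pow i))" for i
    using coeff_smult[of a p i] assms
    by (simp add: QY_stuffle_assoc[OF QY0_imp_QY QY0_imp_QY pow_in_QY] coeff_in_QY0 del: One_nat_def)
  moreover have "stuffle \<mu> a (\<Sum>i<n. f i) = (\<Sum>i<n. stuffle \<mu> a (f i))" for f
    by (induction n) (simp_all add: stuffle_simps)
  ultimately have "power_sum n (?c ?q) = stuffle \<mu> a (power_sum n (?c p))"
    by (simp add: power_sum_def)
  then show ?thesis
    using psi_eq_power_sum[OF q, of n] psi_eq_power_sum[OF p, of n] by (simp add: n_def)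
qed

end

theorem theorem4p3:
  fixes \<mu> :: complex and m :: rat
  assumes "Re \<mu> > 0" and "m > 0"
  shows "psi \<mu> m \<in> algebra_iso (stuffle_algebra0 \<mu>) (UP (stuffle_algebra0 \<mu>)) (stuffle_algebra \<mu>)"
proof -
  interpret slice \<mu> m by unfold_locales (rule assms)
  have "bij_betw (psi \<mu> m) (carrier (UP (stuffle_algebra0 \<mu>))) (QY \<mu>)"
    using psi_inj psi_surj psi_ring_hom by (fastforce simp: bij_betw_def ring_hom_def)
  moreover have "algebra (stuffle_algebra0 \<mu>) (UP (stuffle_algebra0 \<mu>))"
    by (intro UP_cring.UP_algebra UP_cring.intro cring_stuffle_algebra0)
  ultimately show ?thesis
    by (simp add: algebra_iso_def ring_iso_def psi_ring_hom algebra_stuffle_algebra psi_smult)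
qed

end
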